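(* Let $I=(0,1)$ and let $\tilde u,H\in L^\infty(I)$ be real-valued with $\inf_IH>0$. Let $A_0:L^2(I)^2\to L^2(I)^2$ be the bounded operator $$A_0\begin{pmatrix}\phi_1\\ \phi_2\end{pmatrix}=\begin{pmatrix}\tilde u\,\phi_1+H\phi_2\\ g\int_0^1\phi_1\,\mathrm{d}\lambda+\tilde u\,\phi_2\end{pmatrix}.$$ Set $\tilde u_-=\inf_I\tilde u$, $\tilde u_+=\sup_I\tilde u$, $h=\int_0^1H\,\mathrm{d}\lambda$, $J_-=[\tilde u_--\sqrt{gh},\tilde u_-)$ and $J_+=(\tilde u_+,\tilde u_++\sqrt{gh}]$. If either 1. $\tilde u\in C^{0,1/2}(\bar I)$, or 2. $\tilde u\in C^{0,1/4}(\bar I)$ with Hölder constant $K>0$ satisfying $K<\sqrt{2g\inf_IH}$, then there exist exactly two real eigenvalues $c_-\in J_-$ and $c_+\in J_+$ such that $$\sigma(A_0)\cap\mathbb{R}=\{c_-,c_+\}\cup\tilde u(\bar I),$$ or, in other words, $\sigma_d(A_0)\cap\mathbb{R}=\{c_-,c_+\}$.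
   Context: $g>0$ is a constant; $\bar I=[0,1]$; $L^2(I)$ is the space of complex-valued square integrable functions; $\inf_I$, $\sup_I$ are essential infimum and supremum. $C^{0,\alpha}(\bar I)$ is the space of functions $u$ with $|u(x)-u(y)|\leq K|x-y|^\alpha$ for all $x,y\in\bar I$ for some constant $K>0$, called the Hölder constant. $\sigma(A_0)$ is the set of $c\in\mathbb{C}$ such that $A_0-c\mathbf{I}$ is not invertible, and the discrete spectrum $\sigma_d(A_0)$ is the set of $c\in\mathbb{C}$ such that $A_0-c\mathbf{I}$ is not invertible but Fredholm. *)

theory Defs
  imports "HOL-Analysis.Analysis" "HOL-Probability.Essential_Supremum"
begin

class complex_normed_vector = real_normed_vector +
  fixes scaleC :: "complex \<Rightarrow> 'a \<Rightarrow> 'a"  (infixr "*\<^sub>C" 75)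
  assumes scaleC_add_right: "a *\<^sub>C (x + y) = a *\<^sub>C x + a *\<^sub>C y"
    and scaleC_add_left: "(a + b) *\<^sub>C x = a *\<^sub>C x + b *\<^sub>C x"
    and scaleC_scaleC: "a *\<^sub>C b *\<^sub>C x = (a * b) *\<^sub>C x"
    and scaleC_of_real: "complex_of_real r *\<^sub>C x = r *\<^sub>R x"
    and norm_scaleC: "norm (a *\<^sub>C x) = cmod a * norm x"

global_interpretation complex_vector:
  vector_space "scaleC :: complex \<Rightarrow> 'a \<Rightarrow> 'a::complex_normed_vector"
proof
  fix x :: 'a
  show "1 *\<^sub>C x = x"
    using scaleC_of_real[of 1 x] by simp
qed (simp_all add: scaleC_add_right scaleC_add_left scaleC_scaleC)

instantiation prod :: (complex_normed_vector, complex_normed_vector) complex_normed_vector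
begin

definition scaleC_prod :: "complex \<Rightarrow> 'a \<times> 'b \<Rightarrow> 'a \<times> 'b"
  where "scaleC_prod a x = (a *\<^sub>C fst x, a *\<^sub>C snd x)"

instance
proof
  fix a :: complex and x :: "'a \<times> 'b"
  have "norm (a *\<^sub>C x) = sqrt ((cmod a)\<^sup>2 * ((norm (fst x))\<^sup>2 + (norm (snd x))\<^sup>2))"
    by (simp add: scaleC_prod_def norm_prod_def norm_scaleC power_mult_distrib distrib_left)
  then show "norm (a *\<^sub>C x) = cmod a * norm x"
    by (simp add: norm_prod_def real_sqrt_mult)
qed (auto simp: scaleC_prod_def scaleC_add_right scaleC_add_left scaleC_scaleC scaleC_of_real
    prod_eq_iff)

end

definition bounded_clinear ::
    "('a::complex_normed_vector \<Rightarrow> 'b::complex_normed_vector) \<Rightarrow> bool"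
  where "bounded_clinear T \<longleftrightarrow> bounded_linear T \<and> (\<forall>a x. T (a *\<^sub>C x) = a *\<^sub>C T x)"

definition invertible_op ::
    "('a::complex_normed_vector \<Rightarrow> 'b::complex_normed_vector) \<Rightarrow> bool"
  where "invertible_op T \<longleftrightarrow>
    bounded_clinear T \<and> (\<exists>S. bounded_clinear S \<and> S \<circ> T = id \<and> T \<circ> S = id)"

text \<open>Finite-dimensional kernel, closed range and finite codimension, over the complex scalars. For
  bounded operators between Banach spaces closedness of the range follows from the other two.\<close>

definition fredholm ::
    "('a::complex_normed_vector \<Rightarrow> 'b::complex_normed_vector) \<Rightarrow> bool"
  where "fredholm T \<longleftrightarrow> bounded_clinear T \<and>
    (\<exists>B. finite B \<and> {x. T x = 0} \<subseteq> complex_vector.span B) \<and>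
    closed (range T) \<and>
    (\<exists>B. finite B \<and> complex_vector.span (range T \<union> B) = UNIV)"

definition shift_op :: "('a::complex_normed_vector \<Rightarrow> 'a) \<Rightarrow> complex \<Rightarrow> 'a \<Rightarrow> 'a"
  where "shift_op T c = (\<lambda>x. T x - c *\<^sub>C x)"

definition op_spectrum :: "('a::complex_normed_vector \<Rightarrow> 'a) \<Rightarrow> complex set"
  where "op_spectrum T = {c. \<not> invertible_op (shift_op T c)}"

definition discrete_spectrum :: "('a::complex_normed_vector \<Rightarrow> 'a) \<Rightarrow> complex set"
  where "discrete_spectrum T =
    {c. \<not> invertible_op (shift_op T c) \<and> fredholm (shift_op T c)}"

definition op_eigenvalue :: "('a::complex_normed_vector \<Rightarrow> 'a) \<Rightarrow> complex \<Rightarrow> bool"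
  where "op_eigenvalue T c \<longleftrightarrow> (\<exists>x. x \<noteq> 0 \<and> T x = c *\<^sub>C x)"

abbreviation unit_measure :: "real measure"  (\<open>\<lambda>\<^sub>I\<close>)
  where "\<lambda>\<^sub>I \<equiv> lebesgue_on {0<..<1}"

text \<open>Real-valued versions, meant for essentially bounded functions: an infinite essential supremum
  is mapped to 0.\<close>

definition ess_sup :: "'a measure \<Rightarrow> ('a \<Rightarrow> real) \<Rightarrow> real"
  where "ess_sup M f = real_of_ereal (esssup M (\<lambda>x. ereal (f x)))"

definition ess_inf :: "'a measure \<Rightarrow> ('a \<Rightarrow> real) \<Rightarrow> real"
  where "ess_inf M f = - ess_sup M (\<lambda>x. - f x)"

definition ess_bounded :: "(real \<Rightarrow> real) \<Rightarrow> bool"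
  where "ess_bounded f \<longleftrightarrow> f \<in> borel_measurable \<lambda>\<^sub>I \<and> (\<exists>C. AE x in \<lambda>\<^sub>I. \<bar>f x\<bar> \<le> C)"

definition holder_on :: "real set \<Rightarrow> real \<Rightarrow> real \<Rightarrow> (real \<Rightarrow> real) \<Rightarrow> bool"
  where "holder_on S \<alpha> K f \<longleftrightarrow> (\<forall>x\<in>S. \<forall>y\<in>S. \<bar>f x - f y\<bar> \<le> K * \<bar>x - y\<bar> powr \<alpha>)"

definition square_integrable :: "(real \<Rightarrow> complex) \<Rightarrow> bool"
  where "square_integrable f \<longleftrightarrow>
    f \<in> borel_measurable \<lambda>\<^sub>I \<and> integrable \<lambda>\<^sub>I (\<lambda>x. (cmod (f x))\<^sup>2)"

lemma square_integrable_bound: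
  assumes "square_integrable f" "g \<in> borel_measurable \<lambda>\<^sub>I"
    "AE x in \<lambda>\<^sub>I. (cmod (g x)) \<le> C * cmod (f x)"
  shows "square_integrable g"
proof -
  have "integrable \<lambda>\<^sub>I (\<lambda>x. (cmod (g x))\<^sup>2)"
  proof (rule Bochner_Integration.integrable_bound)
    show "integrable \<lambda>\<^sub>I (\<lambda>x. C\<^sup>2 * (cmod (f x))\<^sup>2)"
      using assms(1) by (auto simp: square_integrable_def)
    show "(\<lambda>x. (cmod (g x))\<^sup>2) \<in> borel_measurable \<lambda>\<^sub>I"
      using assms(2) by measurable
    show "AE x in \<lambda>\<^sub>I. norm ((cmod (g x))\<^sup>2) \<le> norm (C\<^sup>2 * (cmod (f x))\<^sup>2)"
      using assms(3)
    proof eventually_elim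
      case (elim x)
      from power_mono[OF this, of 2] show ?case by (simp add: power_mult_distrib)
    qed
  qed
  with assms(2) show ?thesis by (simp add: square_integrable_def)
qed

lemma square_integrable_mult:
  assumes "square_integrable f" "ess_bounded a"
  shows "square_integrable (\<lambda>x. complex_of_real (a x) * f x)"
proof -
  obtain C where C: "AE x in \<lambda>\<^sub>I. \<bar>a x\<bar> \<le> C"
    using assms(2) by (auto simp: ess_bounded_def)
  have [measurable]: "f \<in> borel_measurable \<lambda>\<^sub>I" "a \<in> borel_measurable \<lambda>\<^sub>I"
    using assms by (auto simp: ess_bounded_def square_integrable_def)
  show ?thesis
  proof (rule square_integrable_bound[OF assms(1), where C = C])
    show "AE x in \<lambda>\<^sub>I. cmod (complex_of_real (a x) * f x) \<le> C * cmod (f x)"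
      using C by eventually_elim (simp add: norm_mult mult_right_mono)
  qed measurable
qed

lemma square_integrable_scale:
  assumes "square_integrable f"
  shows "square_integrable (\<lambda>x. a * f x)"
proof (rule square_integrable_bound[OF assms, where C = "cmod a"])
  have [measurable]: "f \<in> borel_measurable \<lambda>\<^sub>I"
    using assms by (auto simp: square_integrable_def)
  show "(\<lambda>x. a * f x) \<in> borel_measurable \<lambda>\<^sub>I" by measurable
qed (simp add: norm_mult)

lemma square_integrable_add:
  assumes "square_integrable f" "square_integrable g"
  shows "square_integrable (\<lambda>x. f x + g x)"
proof -
  have [measurable]: "f \<in> borel_measurable \<lambda>\<^sub>I" "g \<in> borel_measurable \<lambda>\<^sub>I"
    using assms by (auto simp: square_integrable_def)
  have "integrable \<lambda>\<^sub>I (\<lambda>x. (cmod (f x + g x))\<^sup>2)"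
  proof (rule Bochner_Integration.integrable_bound)
    show "integrable \<lambda>\<^sub>I (\<lambda>x. 2 * ((cmod (f x))\<^sup>2 + (cmod (g x))\<^sup>2))"
      using assms by (auto simp: square_integrable_def)
    have "(cmod (f x + g x))\<^sup>2 \<le> 2 * ((cmod (f x))\<^sup>2 + (cmod (g x))\<^sup>2)" for x
    proof -
      have "(cmod (f x + g x))\<^sup>2 \<le> (cmod (f x) + cmod (g x))\<^sup>2"
        by (intro power_mono norm_triangle_ineq) simp
      also have "\<dots> \<le> 2 * ((cmod (f x))\<^sup>2 + (cmod (g x))\<^sup>2)"
        using sum_squares_bound[of "cmod (f x)" "cmod (g x)"] by (simp add: power2_sum)
      finally show ?thesis .
    qed
    then show "AE x in \<lambda>\<^sub>I. norm ((cmod (f x + g x))\<^sup>2)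
        \<le> norm (2 * ((cmod (f x))\<^sup>2 + (cmod (g x))\<^sup>2))" by simp
  qed measurable
  then show ?thesis by (simp add: square_integrable_def)
qed

lemma square_integrable_inner:
  assumes "square_integrable f" "square_integrable g"
  shows "integrable \<lambda>\<^sub>I (\<lambda>x. f x \<bullet> g x)"
proof (rule Bochner_Integration.integrable_bound)
  have [measurable]: "f \<in> borel_measurable \<lambda>\<^sub>I" "g \<in> borel_measurable \<lambda>\<^sub>I"
    using assms by (auto simp: square_integrable_def)
  show "integrable \<lambda>\<^sub>I (\<lambda>x. (cmod (f x))\<^sup>2 + (cmod (g x))\<^sup>2)"
    using assms by (auto simp: square_integrable_def)
  have "\<bar>f x \<bullet> g x\<bar> \<le> (cmod (f x))\<^sup>2 + (cmod (g x))\<^sup>2" for x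
  proof -
    have "0 \<le> (cmod (f x))\<^sup>2" "0 \<le> (cmod (g x))\<^sup>2"
      by simp_all
    then show ?thesis
      using Cauchy_Schwarz_ineq2[of "f x" "g x"] sum_squares_bound[of "cmod (f x)" "cmod (g x)"]
      by argo
  qed
  then show "AE x in \<lambda>\<^sub>I. norm (f x \<bullet> g x) \<le> norm ((cmod (f x))\<^sup>2 + (cmod (g x))\<^sup>2)"
    by simp
  show "(\<lambda>x. f x \<bullet> g x) \<in> borel_measurable \<lambda>\<^sub>I" by measurable
qed

lemma square_integrable_const: "square_integrable (\<lambda>x. a)"
proof -
  interpret finite_measure "\<lambda>\<^sub>I"
    by (rule finite_measureI) (simp add: space_restrict_space emeasure_restrict_space)
  show ?thesis by (simp add: square_integrable_def)
qed

definition L2_eq :: "(real \<Rightarrow> complex) \<Rightarrow> (real \<Rightarrow> complex) \<Rightarrow> bool"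
  where "L2_eq f g \<longleftrightarrow>
    square_integrable f \<and> square_integrable g \<and> (AE x in \<lambda>\<^sub>I. f x = g x)"

text \<open>\<open>L2_I\<close> is $L^2(I)$: square-integrable functions modulo equality almost everywhere.\<close>

quotient_type L2_I = "real \<Rightarrow> complex" / partial: L2_eq
proof (rule part_equivpI)
  show "\<exists>f. L2_eq f f"
    using square_integrable_const[of 0] by (auto simp: L2_eq_def)
  show "symp L2_eq"
    by (auto simp: L2_eq_def symp_def elim: eventually_mono)
  show "transp L2_eq"
  proof (rule transpI)
    fix f g h assume a: "L2_eq f g" "L2_eq g h"
    then have "AE x in \<lambda>\<^sub>I. f x = g x" "AE x in \<lambda>\<^sub>I. g x = h x" by (auto simp: L2_eq_def)
    then have "AE x in \<lambda>\<^sub>I. f x = h x" by eventually_elim simp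
    with a show "L2_eq f h" by (auto simp: L2_eq_def)
  qed
qed

instantiation L2_I :: real_vector
begin

lift_definition zero_L2_I :: L2_I is "\<lambda>x. 0"
  by (simp add: L2_eq_def square_integrable_const)

lift_definition plus_L2_I :: "L2_I \<Rightarrow> L2_I \<Rightarrow> L2_I" is "\<lambda>f g x. f x + g x"
  by (auto simp: L2_eq_def intro: square_integrable_add)

lift_definition uminus_L2_I :: "L2_I \<Rightarrow> L2_I" is "\<lambda>f x. - f x"
  using square_integrable_scale[where a = "-1"] by (auto simp: L2_eq_def)

lift_definition minus_L2_I :: "L2_I \<Rightarrow> L2_I \<Rightarrow> L2_I" is "\<lambda>f g x. f x - g x"
  using square_integrable_scale[where a = "-1"] square_integrable_add[where g = "\<lambda>x. - _ x"]
  by (auto simp: L2_eq_def)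

lift_definition scaleR_L2_I :: "real \<Rightarrow> L2_I \<Rightarrow> L2_I" is "\<lambda>r f x. r *\<^sub>R f x"
  using square_integrable_scale by (auto simp: L2_eq_def scaleR_conv_of_real)

instance
proof
  fix f g h :: L2_I and r s :: real
  show "f + g + h = f + (g + h)"
    by transfer (auto simp: L2_eq_def algebra_simps intro: square_integrable_add)
  show "f + g = g + f"
    by transfer (auto simp: L2_eq_def algebra_simps intro: square_integrable_add)
  show "0 + f = f"
    by transfer (auto simp: L2_eq_def)
  show "- f + f = 0"
    by transfer (auto simp: L2_eq_def square_integrable_const)
  show "f - g = f + - g"
    using square_integrable_scale[where a = "-1"] square_integrable_add[where g = "\<lambda>x. - _ x"]
    by transfer (auto simp: L2_eq_def)
  show "r *\<^sub>R (f + g) = r *\<^sub>R f + r *\<^sub>R g"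
    by transfer (auto simp: L2_eq_def scaleR_conv_of_real distrib_left
        intro!: square_integrable_add square_integrable_scale)
  show "(r + s) *\<^sub>R f = r *\<^sub>R f + s *\<^sub>R f"
    by transfer (auto simp: L2_eq_def scaleR_conv_of_real distrib_right
        intro!: square_integrable_add square_integrable_scale
        dest: square_integrable_scale[where a = "complex_of_real _ + complex_of_real _"])
  show "r *\<^sub>R s *\<^sub>R f = (r * s) *\<^sub>R f"
    by transfer (auto simp: L2_eq_def scaleR_conv_of_real mult.assoc
        intro!: square_integrable_scale)
  show "1 *\<^sub>R f = f"
    by transfer (auto simp: L2_eq_def)
qed

end

instantiation L2_I :: real_inner
begin

lift_definition inner_L2_I :: "L2_I \<Rightarrow> L2_I \<Rightarrow> real" is "\<lambda>f g. \<integral>x. f x \<bullet> g x \<partial>\<lambda>\<^sub>I"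
proof -
  fix f f' g g' assume "L2_eq f f'" "L2_eq g g'"
  then have "AE x in \<lambda>\<^sub>I. f x = f' x" "AE x in \<lambda>\<^sub>I. g x = g' x"
    and [measurable]: "f \<in> borel_measurable \<lambda>\<^sub>I" "g \<in> borel_measurable \<lambda>\<^sub>I"
      "f' \<in> borel_measurable \<lambda>\<^sub>I" "g' \<in> borel_measurable \<lambda>\<^sub>I"
    by (auto simp: L2_eq_def square_integrable_def)
  then show "(\<integral>x. f x \<bullet> g x \<partial>\<lambda>\<^sub>I) = (\<integral>x. f' x \<bullet> g' x \<partial>\<lambda>\<^sub>I)"
    by (intro integral_cong_AE) (auto elim: eventually_elim2)
qed

definition norm_L2_I :: "L2_I \<Rightarrow> real"
  where "norm_L2_I f = sqrt (f \<bullet> f)"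

definition dist_L2_I :: "L2_I \<Rightarrow> L2_I \<Rightarrow> real"
  where "dist_L2_I f g = norm (f - g)"

definition sgn_L2_I :: "L2_I \<Rightarrow> L2_I"
  where "sgn_L2_I f = f /\<^sub>R norm f"

definition uniformity_L2_I :: "(L2_I \<times> L2_I) filter"
  where "uniformity_L2_I = (INF e\<in>{0<..}. principal {(f, g). dist f g < e})"

definition open_L2_I :: "L2_I set \<Rightarrow> bool"
  where "open_L2_I U = (\<forall>f\<in>U. eventually (\<lambda>(f', g). f' = f \<longrightarrow> g \<in> U) uniformity)"

instance
proof
  fix f g h :: L2_I and r :: real
  show "dist f g = norm (f - g)" by (simp add: dist_L2_I_def)
  show "sgn f = f /\<^sub>R norm f" by (simp add: sgn_L2_I_def)
  show "uniformity = (INF e\<in>{0<..}. principal {(f :: L2_I, g). dist f g < e})"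
    by (simp add: uniformity_L2_I_def)
  show "open U = (\<forall>f\<in>U. eventually (\<lambda>(f', g). f' = f \<longrightarrow> g \<in> U) uniformity)"
    for U :: "L2_I set"
    by (simp add: open_L2_I_def)
  show "f \<bullet> g = g \<bullet> f"
    by transfer (simp add: inner_commute)
  show "(f + g) \<bullet> h = f \<bullet> h + g \<bullet> h"
    by transfer (simp add: L2_eq_def inner_add_left square_integrable_inner)
  show "(r *\<^sub>R f) \<bullet> g = r * (f \<bullet> g)"
    by transfer simp
  show "0 \<le> f \<bullet> f"
    by transfer simp
  show "f \<bullet> f = 0 \<longleftrightarrow> f = 0"
  proof (transfer, goal_cases)
    case (1 f)
    then have *: "square_integrable f" by (simp add: L2_eq_def)
    have "(\<integral>x. f x \<bullet> f x \<partial>\<lambda>\<^sub>I) = 0 \<longleftrightarrow> (AE x in \<lambda>\<^sub>I. f x \<bullet> f x = 0)"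
      by (intro integral_nonneg_eq_0_iff_AE square_integrable_inner[OF * *]) simp
    then show ?case
      using * by (simp add: L2_eq_def square_integrable_const)
  qed
  show "norm f = sqrt (f \<bullet> f)" by (simp add: norm_L2_I_def)
qed

end

instantiation L2_I :: complex_normed_vector
begin

lift_definition scaleC_L2_I :: "complex \<Rightarrow> L2_I \<Rightarrow> L2_I" is "\<lambda>a f x. a * f x"
  using square_integrable_scale by (auto simp: L2_eq_def)

instance
proof
  fix a b :: complex and r :: real and f g :: L2_I
  show "a *\<^sub>C (f + g) = a *\<^sub>C f + a *\<^sub>C g"
    by transfer (auto simp: L2_eq_def distrib_left
        intro!: square_integrable_add square_integrable_scale)
  show "(a + b) *\<^sub>C f = a *\<^sub>C f + b *\<^sub>C f"
    by transfer (auto simp: L2_eq_def distrib_right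
        intro!: square_integrable_add square_integrable_scale)
  show "a *\<^sub>C b *\<^sub>C f = (a * b) *\<^sub>C f"
    by transfer (auto simp: L2_eq_def mult.assoc intro!: square_integrable_scale)
  show "complex_of_real r *\<^sub>C f = r *\<^sub>R f"
    by transfer (auto simp: L2_eq_def scaleR_conv_of_real intro!: square_integrable_scale)
  have "(a *\<^sub>C f) \<bullet> (a *\<^sub>C f) = (cmod a)\<^sup>2 * (f \<bullet> f)"
    by transfer (simp add: dot_square_norm norm_mult power_mult_distrib)
  then show "norm (a *\<^sub>C f) = cmod a * norm f"
    by (simp add: norm_eq_sqrt_inner real_sqrt_mult)
qed

end

text \<open>Multiplication by an essentially bounded function; multiplication by any other function is
  set to zero, since it need not preserve square integrability.\<close>

lift_definition mult_L2 :: "(real \<Rightarrow> real) \<Rightarrow> L2_I \<Rightarrow> L2_I"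
  is "\<lambda>a f x. if ess_bounded a then complex_of_real (a x) * f x else 0"
proof -
  fix a :: "real \<Rightarrow> real" and f g assume "L2_eq f g"
  then show "L2_eq (\<lambda>x. if ess_bounded a then complex_of_real (a x) * f x else 0)
      (\<lambda>x. if ess_bounded a then complex_of_real (a x) * g x else 0)"
    by (cases "ess_bounded a") (auto simp: L2_eq_def square_integrable_const square_integrable_mult)
qed

lift_definition const_L2 :: "complex \<Rightarrow> L2_I" is "\<lambda>a x. a"
  by (simp add: L2_eq_def square_integrable_const)

lift_definition integral_L2 :: "L2_I \<Rightarrow> complex" is "\<lambda>f. \<integral>x. f x \<partial>\<lambda>\<^sub>I"
  by (auto simp: L2_eq_def square_integrable_def intro: integral_cong_AE)

definition A0 :: "real \<Rightarrow> (real \<Rightarrow> real) \<Rightarrow> (real \<Rightarrow> real) \<Rightarrow> L2_I \<times> L2_I \<Rightarrow> L2_I \<times> L2_I"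
  where "A0 g u H = (\<lambda>(\<phi>\<^sub>1, \<phi>\<^sub>2).
    (mult_L2 u \<phi>\<^sub>1 + mult_L2 H \<phi>\<^sub>2,
     const_L2 (complex_of_real g * integral_L2 \<phi>\<^sub>1) + mult_L2 u \<phi>\<^sub>2))"

end

theory Submission
  imports Defs "HOL-Probability.Probability_Measure"
begin

text \<open>
  Write \<open>w = u - c\<close>. If \<open>c\<close> lies off the range of \<open>u\<close>, then \<open>w\<close> is bounded away from zero, and the equation
  \<open>(A\<^sub>0 - c) \<phi> = f\<close> determines \<open>\<phi>\<close> from the single number \<open>m = \<integral> \<phi>\<^sub>1\<close>, which has to satisfy a scalar
  equation with coefficient \<open>1 - g \<integral> H / w\<^sup>2\<close>. So \<open>A\<^sub>0 - c\<close> is invertible unless \<open>g \<integral> H / (u - c)\<^sup>2 = 1\<close>, in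
  which case its kernel is one-dimensional and its range is the kernel of a continuous functional. On
  each side of the range of \<open>u\<close> the left-hand side is strictly monotone in \<open>c\<close> and at most \<open>1\<close> at
  distance \<open>sqrt (g * h)\<close>, and the Hoelder condition makes it exceed \<open>1\<close> near the range.

  If \<open>c = u y\<close>, then \<open>\<bar>w x\<bar> \<le> K \<bar>x - y\<bar>\<^sup>1\<^sup>/\<^sup>4\<close>, and no nontrivial combination of the functions
  \<open>\<bar>x - y\<bar> powr (- \<theta>)\<close> with \<open>1/4 < \<theta> < 1/2\<close> is a constant plus \<open>w\<close> times a square-integrable function.
  Hence the range of \<open>A\<^sub>0 - c\<close> has infinite codimension.
\<close>

subsection \<open>Operators on $L^2(I)$\<close>

lemma ess_bounded_mult:
  assumes "ess_bounded a" "ess_bounded b"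
  shows "ess_bounded (\<lambda>x. a x * b x)"
proof -
  have [measurable]: "a \<in> borel_measurable \<lambda>\<^sub>I" "b \<in> borel_measurable \<lambda>\<^sub>I"
    using assms by (auto simp: ess_bounded_def)
  obtain C D where C: "AE x in \<lambda>\<^sub>I. \<bar>a x\<bar> \<le> C" and D: "AE x in \<lambda>\<^sub>I. \<bar>b x\<bar> \<le> D"
    using assms by (auto simp: ess_bounded_def)
  have "AE x in \<lambda>\<^sub>I. \<bar>a x * b x\<bar> \<le> C * D"
    using C D
    by eventually_elim (auto simp: abs_mult intro!: mult_mono)
  then show ?thesis
    by (auto simp: ess_bounded_def)
qed

lemma ess_bounded_const: "ess_bounded (\<lambda>x. k)"
  by (auto simp: ess_bounded_def)

lemma ess_bounded_add:
  assumes "ess_bounded a" "ess_bounded b"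
  shows "ess_bounded (\<lambda>x. a x + b x)"
proof -
  have [measurable]: "a \<in> borel_measurable \<lambda>\<^sub>I" "b \<in> borel_measurable \<lambda>\<^sub>I"
    using assms by (auto simp: ess_bounded_def)
  obtain C D where C: "AE x in \<lambda>\<^sub>I. \<bar>a x\<bar> \<le> C" and D: "AE x in \<lambda>\<^sub>I. \<bar>b x\<bar> \<le> D"
    using assms by (auto simp: ess_bounded_def)
  have "AE x in \<lambda>\<^sub>I. \<bar>a x + b x\<bar> \<le> C + D"
    using C D by eventually_elim simp
  then show ?thesis
    by (auto simp: ess_bounded_def)
qed

lemma ess_bounded_diff_const: "ess_bounded a \<Longrightarrow> ess_bounded (\<lambda>x. a x - c)"
  using ess_bounded_add[OF _ ess_bounded_const[of "- c"]] by simp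

lemma ess_bounded_inverse:
  assumes "w \<in> borel_measurable \<lambda>\<^sub>I" "d > 0" "AE x in \<lambda>\<^sub>I. d \<le> \<bar>w x\<bar>"
  shows "ess_bounded (\<lambda>x. inverse (w x))"
proof -
  have [measurable]: "w \<in> borel_measurable \<lambda>\<^sub>I" by fact
  have "AE x in \<lambda>\<^sub>I. \<bar>inverse (w x)\<bar> \<le> inverse d"
    using assms(3) by eventually_elim (use assms(2) in \<open>auto simp: intro!: le_imp_inverse_le\<close>)
  then show ?thesis
    by (auto simp: ess_bounded_def)
qed

text \<open>Total mass one gives L^2 inside L^1, integrability of essentially bounded functions, and
  norm |z| for the constant function z.\<close>

interpretation I_prob: prob_space "\<lambda>\<^sub>I"
  by (rule prob_spaceI) (simp add: space_restrict_space emeasure_restrict_space)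

lemma ess_bounded_integrable: "ess_bounded a \<Longrightarrow> integrable \<lambda>\<^sub>I a"
  unfolding ess_bounded_def real_norm_def[symmetric] by (elim conjE exE I_prob.integrable_const_bound)

lemma square_integrable_integrable:
  assumes "square_integrable f"
  shows "integrable \<lambda>\<^sub>I f"
proof -
  have f: "f \<in> borel_measurable \<lambda>\<^sub>I" and f2: "integrable \<lambda>\<^sub>I (\<lambda>x. (cmod (f x))\<^sup>2)"
    using assms by (simp_all add: square_integrable_def)
  have "integrable \<lambda>\<^sub>I (\<lambda>x. cmod (f x))"
    using measurable_compose[OF f borel_measurable_norm] f2 by (rule I_prob.square_integrable_imp_integrable)
  then show ?thesis
    by (simp add: integrable_norm_iff[OF f])
qed

lemma mult_L2_mult_L2:
  assumes "ess_bounded a" "ess_bounded b"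
  shows "mult_L2 a (mult_L2 b f) = mult_L2 (\<lambda>x. a x * b x) f"
  using assms ess_bounded_mult[OF assms]
proof (transfer, goal_cases)
  case (1 a b f)
  then have "square_integrable (\<lambda>x. complex_of_real (a x * b x) * f x)"
    by (intro square_integrable_mult) (auto simp: L2_eq_def)
  with 1 show ?case
    by (simp add: L2_eq_def mult.assoc)
qed

lemma mult_L2_cong_AE:
  assumes "AE x in \<lambda>\<^sub>I. a x = b x" "ess_bounded a" "ess_bounded b"
  shows "mult_L2 a f = mult_L2 b f"
  using assms
proof (transfer, goal_cases)
  case (1 a b f)
  from 1(1) have "AE x in \<lambda>\<^sub>I. complex_of_real (a x) * f x = complex_of_real (b x) * f x"
    by eventually_elim simp
  with 1 show ?case
    by (simp add: L2_eq_def square_integrable_mult)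
qed

lemma mult_L2_one [simp]: "mult_L2 (\<lambda>x. 1) f = f"
  by transfer (auto simp: L2_eq_def ess_bounded_const)

lemma mult_L2_add:
  assumes "ess_bounded a"
  shows "mult_L2 a (f + k) = mult_L2 a f + mult_L2 a k"
  using assms by transfer (simp add: L2_eq_def square_integrable_add square_integrable_mult distrib_left)

lemma mult_L2_scaleC:
  assumes "ess_bounded a"
  shows "mult_L2 a (z *\<^sub>C f) = z *\<^sub>C mult_L2 a f"
  using assms by transfer
    (simp add: L2_eq_def square_integrable_scale square_integrable_mult mult.left_commute)

lemma integral_L2_add: "integral_L2 (f + k) = integral_L2 f + integral_L2 k"
  by transfer (auto simp: L2_eq_def square_integrable_integrable)

lemma integral_L2_scaleC: "integral_L2 (z *\<^sub>C f) = z * integral_L2 f"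
  by transfer simp

lemma const_L2_add: "const_L2 (a + b) = const_L2 a + const_L2 b"
  by transfer (auto simp: L2_eq_def square_integrable_const)

lemma const_L2_mult: "const_L2 (a * b) = a *\<^sub>C const_L2 b"
  by transfer (auto simp: L2_eq_def square_integrable_const)

lemma integral_L2_mult_const:
  assumes "ess_bounded a"
  shows "integral_L2 (mult_L2 a (const_L2 z)) = z * complex_of_real (\<integral>x. a x \<partial>\<lambda>\<^sub>I)"
  using assms by transfer (simp add: mult.commute)

lemma mult_L2_diff_const:
  assumes "ess_bounded a"
  shows "mult_L2 (\<lambda>x. a x - c) f = mult_L2 a f - complex_of_real c *\<^sub>C f"
proof -
  have "mult_L2 a f = mult_L2 (\<lambda>x. a x - c) f + complex_of_real c *\<^sub>C f"
    using assms ess_bounded_diff_const[OF assms, of c]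
    by transfer (auto simp: L2_eq_def left_diff_distrib square_integrable_mult)
  then show ?thesis
    by simp
qed

text \<open>Stated for functions rather than classes, so that \<open>transfer\<close> reduces the
  squared form of \<open>norm_mult_L2_le\<close> to it.\<close>

lemma integral_inner_mult_le:
  assumes f: "square_integrable f" and a: "ess_bounded a" and C: "AE x in \<lambda>\<^sub>I. \<bar>a x\<bar> \<le> C"
  shows "(\<integral>x. (complex_of_real (a x) * f x) \<bullet> (complex_of_real (a x) * f x) \<partial>\<lambda>\<^sub>I)
    \<le> C\<^sup>2 * (\<integral>x. f x \<bullet> f x \<partial>\<lambda>\<^sub>I)"
proof -
  note af = square_integrable_mult[OF f a]
  have "(\<integral>x. (complex_of_real (a x) * f x) \<bullet> (complex_of_real (a x) * f x) \<partial>\<lambda>\<^sub>I)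
      \<le> (\<integral>x. C\<^sup>2 * (f x \<bullet> f x) \<partial>\<lambda>\<^sub>I)"
  proof (rule integral_mono_AE)
    show "integrable \<lambda>\<^sub>I (\<lambda>x. (complex_of_real (a x) * f x) \<bullet> (complex_of_real (a x) * f x))"
      by (rule square_integrable_inner[OF af af])
    show "integrable \<lambda>\<^sub>I (\<lambda>x. C\<^sup>2 * (f x \<bullet> f x))"
      by (intro integrable_mult_right square_integrable_inner f)
    show "AE x in \<lambda>\<^sub>I. (complex_of_real (a x) * f x) \<bullet> (complex_of_real (a x) * f x)
        \<le> C\<^sup>2 * (f x \<bullet> f x)"
      using C
    proof eventually_elim
      case (elim x)
      then have "(a x)\<^sup>2 \<le> C\<^sup>2"
        by (metis power2_abs abs_ge_zero power_mono)
      from mult_right_mono[OF this, of "(cmod (f x))\<^sup>2"] show ?case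
        by (simp add: dot_square_norm norm_mult power_mult_distrib)
    qed
  qed
  then show ?thesis
    by simp
qed

lemma norm_mult_L2_le:
  assumes "ess_bounded a" "AE x in \<lambda>\<^sub>I. \<bar>a x\<bar> \<le> C"
  shows "norm (mult_L2 a f) \<le> norm f * \<bar>C\<bar>"
proof -
  have "mult_L2 a f \<bullet> mult_L2 a f \<le> C\<^sup>2 * (f \<bullet> f)"
    using assms by (transfer fixing: C) (simp only: L2_eq_def integral_inner_mult_le if_True)
  then have "sqrt (mult_L2 a f \<bullet> mult_L2 a f) \<le> sqrt (C\<^sup>2 * (f \<bullet> f))"
    by (rule real_sqrt_le_mono)
  then show ?thesis
    by (simp add: norm_eq_sqrt_inner real_sqrt_mult mult.commute)
qed

lemma bounded_clinear_mult_L2: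
  assumes "ess_bounded a"
  shows "bounded_clinear (mult_L2 a)"
proof -
  obtain C where C: "AE x in \<lambda>\<^sub>I. \<bar>a x\<bar> \<le> C"
    using assms by (auto simp: ess_bounded_def)
  have "mult_L2 a (r *\<^sub>R f) = r *\<^sub>R mult_L2 a f" for r f
    using mult_L2_scaleC[OF assms, of "complex_of_real r" f] by (simp only: scaleC_of_real)
  then have "bounded_linear (mult_L2 a)"
    by (intro bounded_linear_intro[where K = "\<bar>C\<bar>"] mult_L2_add norm_mult_L2_le assms C)
  then show ?thesis
    by (simp add: bounded_clinear_def mult_L2_scaleC[OF assms])
qed

lemma inner_const_L2: "f \<bullet> const_L2 z = integral_L2 f \<bullet> z"
proof (transfer, goal_cases)
  case (1 f z)
  then have "integrable \<lambda>\<^sub>I f"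
    by (simp add: L2_eq_def square_integrable_integrable)
  then show ?case
    using integral_inner_left[of z "\<lambda>\<^sub>I" f] by simp
qed

lemma norm_const_L2: "norm (const_L2 z) = cmod z"
proof -
  have "integral_L2 (const_L2 z) = z"
    using I_prob.prob_space by transfer simp
  then show ?thesis
    by (simp add: norm_eq_sqrt_inner inner_const_L2)
qed

text \<open>Cauchy-Schwarz against the constant function whose value is the integral itself; one
  factor of that value then cancels.\<close>

lemma norm_integral_L2_le: "cmod (integral_L2 f) \<le> norm f"
proof -
  let ?z = "integral_L2 f"
  have "cmod ?z * cmod ?z \<le> norm f * cmod ?z"
    using norm_cauchy_schwarz[of f "const_L2 ?z"]
    by (simp add: inner_const_L2 norm_const_L2 dot_square_norm power2_eq_square)
  then show ?thesis
    by (cases "?z = 0") auto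
qed

lemma bounded_linear_integral_L2: "bounded_linear integral_L2"
proof (rule bounded_linear_intro[where K = 1])
  show "integral_L2 (r *\<^sub>R f) = r *\<^sub>R integral_L2 f" for r f
    using integral_L2_scaleC[of "complex_of_real r" f]
    by (simp only: scaleC_of_real scaleR_conv_of_real)
qed (simp_all add: integral_L2_add norm_integral_L2_le)

lemma bounded_linear_const_L2: "bounded_linear const_L2"
proof (rule bounded_linear_intro[where K = 1])
  show "const_L2 (r *\<^sub>R z) = r *\<^sub>R const_L2 z" for r z
    using const_L2_mult[of "complex_of_real r" z]
    by (simp only: scaleC_of_real scaleR_conv_of_real)
qed (simp_all add: const_L2_add norm_const_L2)

lemma bounded_clinear_A0:
  assumes "ess_bounded u" "ess_bounded H"
  shows "bounded_clinear (A0 g u H)"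
proof -
  note u = bounded_clinear_mult_L2[OF assms(1), unfolded bounded_clinear_def, THEN conjunct1]
  note H = bounded_clinear_mult_L2[OF assms(2), unfolded bounded_clinear_def, THEN conjunct1]
  have "bounded_linear (\<lambda>p. complex_of_real g * integral_L2 (fst p))"
    by (intro bounded_linear_compose[OF bounded_linear_mult_right]
        bounded_linear_compose[OF bounded_linear_integral_L2 bounded_linear_fst])
  then have "bounded_linear (\<lambda>p. const_L2 (complex_of_real g * integral_L2 (fst p)))"
    by (rule bounded_linear_compose[OF bounded_linear_const_L2])
  then have "bounded_linear (A0 g u H)"
    unfolding A0_def case_prod_beta
    by (intro bounded_linear_Pair bounded_linear_add
        bounded_linear_compose[OF u bounded_linear_fst] bounded_linear_compose[OF u bounded_linear_snd]
        bounded_linear_compose[OF H bounded_linear_snd])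
  moreover have "A0 g u H (z *\<^sub>C x) = z *\<^sub>C A0 g u H x" for z x
  proof -
    have "const_L2 (complex_of_real g * (z * integral_L2 (fst x)))
        = z *\<^sub>C const_L2 (complex_of_real g * integral_L2 (fst x))"
      by (subst const_L2_mult[symmetric]) (simp only: mult.left_commute)
    then show ?thesis
      unfolding A0_def scaleC_prod_def case_prod_beta fst_conv snd_conv mult_L2_scaleC[OF assms(1)]
        mult_L2_scaleC[OF assms(2)] integral_L2_scaleC scaleC_add_right
      by (simp only:)
  qed
  ultimately show ?thesis
    by (simp add: bounded_clinear_def)
qed

text \<open>\<open>u\<close> sits on both diagonal entries, so subtracting a real multiple of the
  identity gives an operator of the same form. It therefore suffices to study
  \<open>A0 g w H\<close> itself.\<close>

lemma shift_op_A0: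
  assumes "ess_bounded u"
  shows "shift_op (A0 g u H) (complex_of_real c) = A0 g (\<lambda>x. u x - c) H"
proof
  fix x
  show "shift_op (A0 g u H) (complex_of_real c) x = A0 g (\<lambda>x. u x - c) H x"
    unfolding shift_op_def A0_def scaleC_prod_def case_prod_beta mult_L2_diff_const[OF assms]
    by simp
qed

subsection \<open>Off the range of $u$\<close>

lemma bounded_linear_mult_L2: "ess_bounded a \<Longrightarrow> bounded_linear (mult_L2 a)"
  using bounded_clinear_mult_L2 by (simp add: bounded_clinear_def)

lemma mult_L2_diff: "ess_bounded a \<Longrightarrow> mult_L2 a (f - k) = mult_L2 a f - mult_L2 a k"
  by (rule bounded_linear.linear[THEN linear_diff, OF bounded_linear_mult_L2])

lemma mult_L2_0_right: "ess_bounded a \<Longrightarrow> mult_L2 a 0 = 0"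
  by (rule bounded_linear.linear[THEN linear_0, OF bounded_linear_mult_L2])

lemma integral_L2_0: "integral_L2 0 = 0"
  by (rule bounded_linear.linear[THEN linear_0, OF bounded_linear_integral_L2])

lemma integral_const_L2: "integral_L2 (const_L2 z) = z"
  using I_prob.prob_space by transfer simp

lemma scaleC_diff_right: "a *\<^sub>C (x - y) = a *\<^sub>C x - a *\<^sub>C y"
  by (rule complex_vector.scale_right_diff_distrib)

text \<open>Here multiplication by \<open>w\<close> has a bounded inverse. Since
  \<open>inverse 0 = 0\<close>, a bound on the inverse alone would not exclude zeros of
  \<open>w\<close>, which is why \<open>w_nonzero\<close> is stated as well.\<close>

locale off_range =
  fixes g :: real and w H :: "real \<Rightarrow> real"
  assumes w: "ess_bounded w" and H: "ess_bounded H"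
    and inverse_w: "ess_bounded (\<lambda>x. inverse (w x))"
    and w_nonzero: "AE x in \<lambda>\<^sub>I. w x \<noteq> 0"
begin

definition R :: "L2_I \<Rightarrow> L2_I"
  where "R = mult_L2 (\<lambda>x. inverse (w x))"

text \<open>For \<open>w = u - c\<close> the equation \<open>g * q = 1\<close> is the dispersion
  relation of the problem.\<close>

definition q :: real
  where "q = (\<integral>x. H x / (w x)\<^sup>2 \<partial>\<lambda>\<^sub>I)"

text \<open>This is the integral of the first component of \<open>solution 0 f\<close>. When
  \<open>g * q = 1\<close>, its vanishing is the solvability condition for the right-hand side
  \<open>f\<close>.\<close>

definition functional :: "L2_I \<times> L2_I \<Rightarrow> complex"
  where "functional f = integral_L2 (R (fst f - mult_L2 H (R (snd f))))"

text \<open>The only solution of \<open>A0 g w H \<phi> = f\<close> with prescribed value \<open>m\<close> of \<open>integral_L2 (fst \<phi>)\<close>.\<close>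

definition solution :: "complex \<Rightarrow> L2_I \<times> L2_I \<Rightarrow> L2_I \<times> L2_I"
  where "solution m f = (let \<phi>\<^sub>2 = R (snd f - const_L2 (complex_of_real g * m))
    in (R (fst f - mult_L2 H \<phi>\<^sub>2), \<phi>\<^sub>2))"

lemma mult_R [simp]: "mult_L2 w (R f) = f"
proof -
  have "mult_L2 w (R f) = mult_L2 (\<lambda>x. w x * inverse (w x)) f"
    unfolding R_def by (rule mult_L2_mult_L2[OF w inverse_w])
  also have "\<dots> = mult_L2 (\<lambda>x. 1) f"
  proof (rule mult_L2_cong_AE)
    show "AE x in \<lambda>\<^sub>I. w x * inverse (w x) = 1"
      using w_nonzero by eventually_elim simp
  qed (intro ess_bounded_mult w inverse_w ess_bounded_const)+
  finally show ?thesis by simp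
qed

lemma R_mult [simp]: "R (mult_L2 w f) = f"
proof -
  have "R (mult_L2 w f) = mult_L2 (\<lambda>x. inverse (w x) * w x) f"
    unfolding R_def by (rule mult_L2_mult_L2[OF inverse_w w])
  also have "\<dots> = mult_L2 w (R f)"
    unfolding R_def mult_L2_mult_L2[OF w inverse_w] by (simp only: mult.commute)
  finally show ?thesis by simp
qed

lemma bounded_linear_R: "bounded_linear R"
  unfolding R_def by (rule bounded_linear_mult_L2[OF inverse_w])

lemma R_diff: "R (f - k) = R f - R k"
  unfolding R_def by (rule mult_L2_diff[OF inverse_w])

lemma R_scaleC: "R (z *\<^sub>C f) = z *\<^sub>C R f"
  unfolding R_def by (rule mult_L2_scaleC[OF inverse_w])

lemma R_0: "R 0 = 0"
  unfolding R_def by (rule mult_L2_0_right[OF inverse_w])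

text \<open>The feedback of the unknown integral on itself: a constant passes through the second row
  by \<open>R\<close>, through the coupling \<open>H\<close>, and through the first row by
  \<open>R\<close>, which amounts to multiplication by \<open>H x / (w x)\<^sup>2\<close>.\<close>

lemma integral_R_mult_R_const: "integral_L2 (R (mult_L2 H (R (const_L2 z)))) = z * complex_of_real q"
proof -
  have b: "ess_bounded (\<lambda>x. H x * inverse (w x))"
    by (intro ess_bounded_mult H inverse_w)
  have "R (mult_L2 H (R (const_L2 z))) = mult_L2 (\<lambda>x. inverse (w x) * (H x * inverse (w x))) (const_L2 z)"
    unfolding R_def mult_L2_mult_L2[OF H inverse_w] mult_L2_mult_L2[OF inverse_w b] ..
  also have "(\<lambda>x. inverse (w x) * (H x * inverse (w x))) = (\<lambda>x. H x / (w x)\<^sup>2)"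
    by (simp add: fun_eq_iff power2_eq_square field_simps)
  finally show ?thesis
    using integral_L2_mult_const[of "\<lambda>x. H x / (w x)\<^sup>2" z] ess_bounded_mult[OF inverse_w b]
    unfolding q_def by (simp add: power2_eq_square divide_inverse mult_ac)
qed

text \<open>With the integral treated as a known number, applying \<open>R\<close> solves the second
  row and then the first. The right-hand side still contains \<open>\<phi>\<close>, but only through
  that number, so the operator equation reduces to a scalar one.\<close>

lemma A0_eq_iff: "A0 g w H \<phi> = f \<longleftrightarrow> \<phi> = solution (integral_L2 (fst \<phi>)) f"
proof
  assume "A0 g w H \<phi> = f"
  then have "fst f = mult_L2 w (fst \<phi>) + mult_L2 H (snd \<phi>)"
    "snd f = const_L2 (complex_of_real g * integral_L2 (fst \<phi>)) + mult_L2 w (snd \<phi>)"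
    by (auto simp: A0_def case_prod_unfold)
  then show "\<phi> = solution (integral_L2 (fst \<phi>)) f"
    by (simp add: solution_def Let_def prod_eq_iff)
next
  assume "\<phi> = solution (integral_L2 (fst \<phi>)) f"
  then have 1: "fst \<phi> = R (fst f - mult_L2 H (snd \<phi>))"
    and 2: "snd \<phi> = R (snd f - const_L2 (complex_of_real g * integral_L2 (fst \<phi>)))"
    by (simp_all add: solution_def Let_def prod_eq_iff)
  from arg_cong[OF 1, of "mult_L2 w"] arg_cong[OF 2, of "mult_L2 w"]
  show "A0 g w H \<phi> = f"
    by (simp add: A0_def case_prod_unfold prod_eq_iff)
qed

lemma integral_solution:
  "integral_L2 (fst (solution m f)) = functional f + complex_of_real (g * q) * m"
proof -
  have "fst (solution m f)
      = R (fst f - mult_L2 H (R (snd f))) + R (mult_L2 H (R (const_L2 (complex_of_real g * m))))"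
    by (simp add: solution_def Let_def R_diff mult_L2_diff[OF H])
  then show ?thesis
    by (simp add: functional_def integral_L2_add integral_R_mult_R_const)
qed

text \<open>The hypothesis is a consistency condition: the number put in for the integral is the one
  that comes out, by \<open>integral_solution\<close>.\<close>

lemma A0_solution:
  assumes "m = functional f + complex_of_real (g * q) * m"
  shows "A0 g w H (solution m f) = f"
proof -
  have "integral_L2 (fst (solution m f)) = m"
    by (simp only: integral_solution assms[symmetric])
  then show ?thesis
    by (simp only: A0_eq_iff)
qed

lemma integral_eq_functional:
  assumes "A0 g w H \<phi> = f"
  shows "(1 - complex_of_real (g * q)) * integral_L2 (fst \<phi>) = functional f"
proof -
  have "integral_L2 (fst \<phi>) = functional f + complex_of_real (g * q) * integral_L2 (fst \<phi>)"
    using assms unfolding A0_eq_iff by (metis integral_solution)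
  then show ?thesis
    by (simp add: algebra_simps)
qed

lemma bounded_linear_functional: "bounded_linear functional"
  unfolding functional_def
  by (intro bounded_linear_compose[OF bounded_linear_integral_L2]
      bounded_linear_compose[OF bounded_linear_R] bounded_linear_sub bounded_linear_fst
      bounded_linear_compose[OF bounded_linear_mult_L2[OF H]] bounded_linear_snd)

lemma functional_scaleC: "functional (z *\<^sub>C f) = z * functional f"
  unfolding functional_def scaleC_prod_def fst_conv snd_conv R_scaleC mult_L2_scaleC[OF H]
    scaleC_diff_right[symmetric] integral_L2_scaleC ..

text \<open>\<open>m\<close> depends on \<open>f\<close> here because the inverse operator puts in a
  multiple of \<open>functional f\<close>.\<close>

lemma bounded_linear_solution:
  assumes "bounded_linear m"
  shows "bounded_linear (\<lambda>f. solution (m f) f)"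
proof -
  have "bounded_linear (\<lambda>f. complex_of_real g * m f)"
    using assms by (rule bounded_linear_const_mult)
  then have "bounded_linear (\<lambda>f. const_L2 (complex_of_real g * m f))"
    by (rule bounded_linear_compose[OF bounded_linear_const_L2])
  then have 2: "bounded_linear (\<lambda>f. R (snd f - const_L2 (complex_of_real g * m f)))"
    by (intro bounded_linear_compose[OF bounded_linear_R] bounded_linear_sub bounded_linear_snd)
  show ?thesis
    unfolding solution_def Let_def
    by (intro bounded_linear_Pair bounded_linear_compose[OF bounded_linear_R] bounded_linear_sub
        bounded_linear_fst bounded_linear_compose[OF bounded_linear_mult_L2[OF H]] 2)
qed

lemma solution_scaleC: "solution (z * m) (z *\<^sub>C f) = z *\<^sub>C solution m f"
proof -
  have "const_L2 (complex_of_real g * (z * m)) = z *\<^sub>C const_L2 (complex_of_real g * m)"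
    by (subst const_L2_mult[symmetric]) (simp only: mult.left_commute)
  then show ?thesis
    unfolding solution_def scaleC_prod_def Let_def fst_conv snd_conv
    by (simp only: R_scaleC mult_L2_scaleC[OF H] scaleC_diff_right[symmetric])
qed

lemma invertible_A0:
  assumes "g * q \<noteq> 1"
  shows "invertible_op (A0 g w H)"
proof -
  define k where "k = 1 - complex_of_real (g * q)"
  have k: "k \<noteq> 0"
    using assms unfolding k_def by (metis eq_iff_diff_eq_0 of_real_eq_1_iff)
  \<comment> \<open>The scalar equation says that \<open>k\<close> times the integral is
    \<open>functional f\<close>, so this is the only possible value of \<open>m\<close>.\<close>
  define S where "S f = solution (inverse k * functional f) f" for f
  have "S (z *\<^sub>C f) = z *\<^sub>C S f" for z f
    unfolding S_def functional_scaleC by (metis solution_scaleC mult.left_commute)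
  moreover have "bounded_linear S"
    unfolding S_def
    by (intro bounded_linear_solution bounded_linear_const_mult bounded_linear_functional)
  ultimately have "bounded_clinear S"
    by (simp add: bounded_clinear_def)
  moreover have "S (A0 g w H \<phi>) = \<phi>" for \<phi>
  proof -
    have "inverse k * functional (A0 g w H \<phi>) = integral_L2 (fst \<phi>)"
      using integral_eq_functional[of \<phi>, OF refl, folded k_def] k
      by (metis mult.assoc left_inverse mult_1)
    then show ?thesis
      using A0_eq_iff[of \<phi> "A0 g w H \<phi>"] by (simp add: S_def)
  qed
  moreover have "A0 g w H (S f) = f" for f
    unfolding S_def
  proof (rule A0_solution)
    have "x = y + z * x" if "(1 - z) * x = y" for x y z :: complex
      using that by (auto simp: left_diff_distrib)
    moreover have "k * (inverse k * functional f) = functional f"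
      using k by simp
    ultimately show "inverse k * functional f
        = functional f + complex_of_real (g * q) * (inverse k * functional f)"
      unfolding k_def .
  qed
  ultimately show ?thesis
    using bounded_clinear_A0[OF w H] by (auto simp: invertible_op_def fun_eq_iff)
qed

text \<open>\<open>solution\<close> is jointly homogeneous in its two arguments, so every kernel
  element is a multiple of \<open>solution 1 0\<close>. That vector is nonzero because its first
  component has integral one.\<close>

lemma kernel_A0:
  assumes "g * q = 1"
  shows "A0 g w H (solution 1 0) = 0" "solution 1 0 \<noteq> 0"
    "A0 g w H \<phi> = 0 \<Longrightarrow> \<phi> = integral_L2 (fst \<phi>) *\<^sub>C solution 1 0"
proof -
  have f0: "functional 0 = 0"
    by (rule bounded_linear.linear[THEN linear_0, OF bounded_linear_functional])
  show "A0 g w H (solution 1 0) = 0"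
    by (rule A0_solution) (simp add: assms f0)
  have "integral_L2 (fst (solution 1 0)) = 1"
    unfolding integral_solution by (simp add: assms f0)
  then show "solution 1 0 \<noteq> 0"
    by (auto simp: integral_L2_0)
  show "\<phi> = integral_L2 (fst \<phi>) *\<^sub>C solution 1 0" if "A0 g w H \<phi> = 0"
    using that solution_scaleC[of "integral_L2 (fst \<phi>)" 1 0]
    unfolding A0_eq_iff by (metis complex_vector.scale_zero_right mult.right_neutral)
qed

text \<open>When \<open>g * q = 1\<close>, the number \<open>m\<close> cancels from its own scalar
  equation, and only the condition on \<open>f\<close> remains.\<close>

lemma range_A0:
  assumes "g * q = 1"
  shows "range (A0 g w H) = {f. functional f = 0}"
proof (intro equalityI subsetI)
  fix f
  assume "f \<in> range (A0 g w H)"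
  then obtain \<phi> where "f = A0 g w H \<phi>"
    by blast
  then show "f \<in> {f. functional f = 0}"
    using integral_eq_functional[of \<phi> f] by (simp add: assms)
next
  fix f
  assume "f \<in> {f. functional f = 0}"
  \<comment> \<open>Every \<open>m\<close> is consistent here; zero is the simplest choice.\<close>
  then have "A0 g w H (solution 0 f) = f"
    by (intro A0_solution) simp
  then show "f \<in> range (A0 g w H)"
    by (metis rangeI)
qed

text \<open>The kernel is a line, and the range is the zero set of a nonzero continuous functional,
  hence closed and of codimension one.\<close>

lemma fredholm_A0:
  assumes "g * q = 1"
  shows "fredholm (A0 g w H)"
  unfolding fredholm_def
proof (intro conjI)
  show "bounded_clinear (A0 g w H)"
    by (rule bounded_clinear_A0[OF w H])
  have "{\<phi>. A0 g w H \<phi> = 0} \<subseteq> complex_vector.span {solution 1 0}"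
  proof
    fix \<phi>
    assume "\<phi> \<in> {\<phi>. A0 g w H \<phi> = 0}"
    then have "A0 g w H \<phi> = 0"
      by simp
    then have "\<phi> = integral_L2 (fst \<phi>) *\<^sub>C solution 1 0"
      by (rule kernel_A0(3)[OF assms])
    then show "\<phi> \<in> complex_vector.span {solution 1 0}"
      by (metis complex_vector.span_base complex_vector.span_scale singletonI)
  qed
  then show "\<exists>B. finite B \<and> {\<phi>. A0 g w H \<phi> = 0} \<subseteq> complex_vector.span B"
    by (intro exI[of _ "{solution 1 0}"]) simp
  show "closed (range (A0 g w H))"
    unfolding range_A0[OF assms]
    by (intro closed_Collect_eq bounded_linear.continuous_on[OF bounded_linear_functional]
        continuous_on_id continuous_on_const)
  \<comment> \<open>\<open>R\<close> undoes the multiplication by \<open>w\<close>, so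
    \<open>functional e\<close> is the integral of the constant one; hence \<open>e\<close> spans a
    complement of the range.\<close>
  define e :: "L2_I \<times> L2_I" where "e = (mult_L2 w (const_L2 1), 0)"
  have e: "functional e = 1"
    by (simp add: functional_def e_def R_0 mult_L2_0_right[OF H] integral_const_L2)
  have "f \<in> complex_vector.span (range (A0 g w H) \<union> {e})" for f
  proof -
    have "functional (f - functional f *\<^sub>C e) = functional f - functional (functional f *\<^sub>C e)"
      by (rule bounded_linear.linear[THEN linear_diff, OF bounded_linear_functional])
    then have "f - functional f *\<^sub>C e \<in> range (A0 g w H)"
      by (simp add: range_A0[OF assms] functional_scaleC e)
    then have "(f - functional f *\<^sub>C e) + functional f *\<^sub>C e
        \<in> complex_vector.span (range (A0 g w H) \<union> {e})"
      by (intro complex_vector.span_add complex_vector.span_scale complex_vector.span_base) auto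
    then show ?thesis
      by simp
  qed
  then show "\<exists>B. finite B \<and> complex_vector.span (range (A0 g w H) \<union> B) = UNIV"
    by (intro exI[of _ "{e}"]) auto
qed

lemma nontrivial_kernel_A0:
  assumes "g * q = 1"
  shows "\<exists>\<phi>. \<phi> \<noteq> 0 \<and> A0 g w H \<phi> = 0"
  using kernel_A0[OF assms] by blast

end

subsection \<open>Integrals of radial functions\<close>

text \<open>Passes from a gauge integral on the closed interval, which the fundamental theorem of
  calculus supplies, to the Lebesgue integral on the open one. Nonnegativity turns gauge
  integrability into absolute integrability.\<close>

lemma integrable_I_nonneg:
  fixes f :: "real \<Rightarrow> real"
  assumes f: "(f has_integral v) {0..1}" and nonneg: "\<And>x. x \<in> {0<..<1} \<Longrightarrow> 0 \<le> f x"
  shows "integrable \<lambda>\<^sub>I f" and "(\<integral>x. f x \<partial>\<lambda>\<^sub>I) = v"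
proof -
  have v: "(f has_integral v) {0<..<1}"
    using f by (simp only: has_integral_Icc_iff_Ioo)
  then have "f absolutely_integrable_on {0<..<1}"
    using nonneg by (intro nonnegative_absolutely_integrable_1) (auto simp: integrable_on_def)
  then show i: "integrable \<lambda>\<^sub>I f"
    by (simp add: set_integrable_def integrable_restrict_space)
  show "(\<integral>x. f x \<partial>\<lambda>\<^sub>I) = v"
    using lebesgue_integral_eq_integral[OF i] v by (simp add: integral_unique)
qed

text \<open>\<open>\<Phi>\<close> is an antiderivative of the profile \<open>G\<close>. The two
  brackets are the integrals of the profile over the points of [0,1] to the left and to the right of
  \<open>y\<close> at distance at least \<eta>; the maximum makes a bracket vanish when its side is
  shorter than \<eta>.\<close>

lemma integral_ge_radial:
  fixes F G \<Phi> :: "real \<Rightarrow> real"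
  assumes F: "integrable \<lambda>\<^sub>I F" and nonneg: "AE x in \<lambda>\<^sub>I. 0 \<le> F x"
    and ge: "AE x in \<lambda>\<^sub>I. \<eta> \<le> \<bar>x - y\<bar> \<longrightarrow> G \<bar>x - y\<bar> \<le> F x"
    and y: "y \<in> {0..1}" and \<eta>: "\<eta> > 0"
    and deriv: "\<And>s. s > 0 \<Longrightarrow> (\<Phi> has_real_derivative G s) (at s)"
    and G: "\<And>s. s > 0 \<Longrightarrow> 0 \<le> G s"
  shows "(\<Phi> (max \<eta> y) - \<Phi> \<eta>) + (\<Phi> (max \<eta> (1 - y)) - \<Phi> \<eta>) \<le> (\<integral>x. F x \<partial>\<lambda>\<^sub>I)"
proof -
  define l where "l x = (if x \<in> {0..y - \<eta>} then G (y - x) else 0)" for x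
  define r where "r x = (if x \<in> {y + \<eta>..1} then G (x - y) else 0)" for x
  have "((\<lambda>x. G (y - x)) has_integral (\<Phi> (max \<eta> y) - \<Phi> \<eta>)) {0..y - \<eta>}"
  proof (cases "\<eta> \<le> y")
    case True
    have "((\<lambda>x. G (y - x)) has_integral (- \<Phi> (y - (y - \<eta>)) - (- \<Phi> (y - 0)))) {0..y - \<eta>}"
    proof (rule fundamental_theorem_of_calculus)
      fix x assume "x \<in> {0..y - \<eta>}"
      then have "((\<lambda>x. - \<Phi> (y - x)) has_real_derivative G (y - x)) (at x)"
        using \<eta> DERIV_minus[OF DERIV_chain2[OF deriv, of "\<lambda>x. y - x" x "- 1"]]
          DERIV_diff[OF DERIV_const[of y "at x"] DERIV_ident]
        by auto
      then show "((\<lambda>x. - \<Phi> (y - x)) has_vector_derivative G (y - x)) (at x within {0..y - \<eta>})"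
        by (simp add: has_real_derivative_iff_has_vector_derivative has_vector_derivative_at_within)
    qed (use True in simp)
    then show ?thesis
      using True by (simp add: max_def)
  qed (auto simp: max_def)
  then have l: "(l has_integral (\<Phi> (max \<eta> y) - \<Phi> \<eta>)) {0..1}"
    unfolding l_def using y \<eta> by (subst has_integral_restrict) auto
  have "((\<lambda>x. G (x - y)) has_integral (\<Phi> (max \<eta> (1 - y)) - \<Phi> \<eta>)) {y + \<eta>..1}"
  proof (cases "\<eta> \<le> 1 - y")
    case True
    have "((\<lambda>x. G (x - y)) has_integral (\<Phi> (1 - y) - \<Phi> (y + \<eta> - y))) {y + \<eta>..1}"
    proof (rule fundamental_theorem_of_calculus)
      fix x assume "x \<in> {y + \<eta>..1}"
      then have "((\<lambda>x. \<Phi> (x - y)) has_real_derivative G (x - y)) (at x)"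
        using \<eta> DERIV_chain2[OF deriv, of "\<lambda>x. x - y" x 1]
          DERIV_diff[OF DERIV_ident DERIV_const[of y "at x"]]
        by auto
      then show "((\<lambda>x. \<Phi> (x - y)) has_vector_derivative G (x - y)) (at x within {y + \<eta>..1})"
        by (simp add: has_real_derivative_iff_has_vector_derivative has_vector_derivative_at_within)
    qed (use True in simp)
    then show ?thesis
      using True by (simp add: max_def)
  qed (auto simp: max_def)
  then have r: "(r has_integral (\<Phi> (max \<eta> (1 - y)) - \<Phi> \<eta>)) {0..1}"
    unfolding r_def using y \<eta> by (subst has_integral_restrict) auto
  have nn: "0 \<le> l x + r x" for x
    using \<eta> by (auto simp: l_def r_def intro!: G add_nonneg_nonneg)
  note lr = integrable_I_nonneg[OF has_integral_add[OF l r] nn]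
  have "(\<integral>x. l x + r x \<partial>\<lambda>\<^sub>I) \<le> (\<integral>x. F x \<partial>\<lambda>\<^sub>I)"
  proof (rule integral_mono_AE[OF lr(1) F])
    \<comment> \<open>As \<eta> > 0, the supports of \<open>l\<close> and \<open>r\<close> are
      disjoint, so at most one summand is nonzero at each point.\<close>
    show "AE x in \<lambda>\<^sub>I. l x + r x \<le> F x"
      using nonneg ge by eventually_elim (use \<eta> in \<open>auto simp: l_def r_def\<close>)
  qed
  then show ?thesis
    by (simp add: lr(2))
qed

lemma integral_ge_log:
  fixes F :: "real \<Rightarrow> real"
  assumes F: "integrable \<lambda>\<^sub>I F" "AE x in \<lambda>\<^sub>I. 0 \<le> F x"
    and ge: "AE x in \<lambda>\<^sub>I. \<eta> \<le> \<bar>x - y\<bar> \<longrightarrow> A / \<bar>x - y\<bar> \<le> F x"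
    and y: "y \<in> {0..1}" and \<eta>: "\<eta> > 0" and A: "A \<ge> 0"
  shows "A * (ln (1/2) - ln \<eta>) \<le> (\<integral>x. F x \<partial>\<lambda>\<^sub>I)"
proof -
  have "(A * ln (max \<eta> y) - A * ln \<eta>) + (A * ln (max \<eta> (1 - y)) - A * ln \<eta>) \<le> (\<integral>x. F x \<partial>\<lambda>\<^sub>I)"
    using A by (intro integral_ge_radial[where G = "\<lambda>s. A / s", OF F ge y \<eta>])
      (auto intro!: derivative_eq_intros)
  moreover have "A * (ln (1/2) + ln \<eta>) \<le> A * (ln (max \<eta> y) + ln (max \<eta> (1 - y)))"
  proof (rule mult_left_mono[OF _ A])
    \<comment> \<open>The longer side of \<open>y\<close> has length at least 1/2; the other bracket
      is only bounded below by zero.\<close>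
    have "ln (1/2) \<le> ln (max \<eta> y) \<and> ln \<eta> \<le> ln (max \<eta> (1 - y)) \<or>
        ln (1/2) \<le> ln (max \<eta> (1 - y)) \<and> ln \<eta> \<le> ln (max \<eta> y)"
    proof (cases "y \<ge> 1/2")
      case True
      then show ?thesis using \<eta> by (intro disjI1 conjI ln_mono) (auto simp: max_def)
    next
      case False
      then show ?thesis using \<eta> by (intro disjI2 conjI ln_mono) (auto simp: max_def)
    qed
    then show "ln (1/2) + ln \<eta> \<le> ln (max \<eta> y) + ln (max \<eta> (1 - y))"
      by auto
  qed
  ultimately show ?thesis
    by (simp add: algebra_simps)
qed

text \<open>The bound of \<open>integral_ge_log\<close> grows without limit as \<eta> tends to 0, so
  no finite integral can dominate it.\<close>

lemma not_integrable_inverse_distance: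
  fixes F :: "real \<Rightarrow> real"
  assumes nonneg: "AE x in \<lambda>\<^sub>I. 0 \<le> F x" and y: "y \<in> {0..1}" and A: "A > 0" and t: "t > 0"
    and ge: "AE x in \<lambda>\<^sub>I. 0 < \<bar>x - y\<bar> \<and> \<bar>x - y\<bar> < t \<longrightarrow> A / \<bar>x - y\<bar> \<le> F x"
  shows "\<not> integrable \<lambda>\<^sub>I F"
proof
  assume "integrable \<lambda>\<^sub>I F"
  \<comment> \<open>The added constant \<open>A / t\<close> extends the lower bound
    \<open>A / \<bar>x - y\<bar>\<close> to distances at least \<open>t\<close>, where only
    nonnegativity of \<open>F\<close> is known.\<close>
  then have F: "integrable \<lambda>\<^sub>I (\<lambda>x. F x + A / t)"
    by (intro Bochner_Integration.integrable_add) auto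
  define X where "X = (\<integral>x. F x + A / t \<partial>\<lambda>\<^sub>I)"
  have "A * (ln (1/2) - ln \<eta>) \<le> X" if \<eta>: "\<eta> > 0" for \<eta>
    unfolding X_def
  proof (rule integral_ge_log[OF F _ _ y \<eta>])
    show "AE x in \<lambda>\<^sub>I. 0 \<le> F x + A / t"
      using nonneg by eventually_elim (use A t in auto)
    show "AE x in \<lambda>\<^sub>I. \<eta> \<le> \<bar>x - y\<bar> \<longrightarrow> A / \<bar>x - y\<bar> \<le> F x + A / t"
      using nonneg ge
    proof eventually_elim
      case (elim x)
      have "A / \<bar>x - y\<bar> \<le> A / t" if "t \<le> \<bar>x - y\<bar>"
        using that t A by (intro divide_left_mono) auto
      moreover have "0 < A / t"
        using A t by simp
      ultimately show ?case
        using elim \<eta> by fastforce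
    qed
  qed (use A in simp)
  \<comment> \<open>This \<eta> makes the left-hand side exactly \<open>X + A\<close>.\<close>
  from this[of "exp (ln (1/2) - X / A - 1)"] have "X + A \<le> X"
    using A by (simp add: algebra_simps)
  then show False
    using A by simp
qed

lemma square_integrable_powr:
  assumes y: "y \<in> {0..1}" and \<theta>: "\<theta> < 1/2"
  shows "square_integrable (\<lambda>x. complex_of_real (\<bar>x - y\<bar> powr (- \<theta>)))"
proof -
  \<comment> \<open>Squaring the function gives the distance to the power \<open>b - 1\<close>, with
    antiderivative s^b / b in the distance s. Since \<open>b > 0\<close>, this is continuous up to s
    = 0, as the interior form of the fundamental theorem requires.\<close>
  define b where "b = 1 - 2 * \<theta>"
  have b: "b > 0"
    using \<theta> by (simp add: b_def)
  have "((\<lambda>x. \<bar>x - y\<bar> powr (b - 1)) has_integral (- ((y - y) powr b / b) - (- ((y - 0) powr b / b)))) {0..y}"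
  proof (rule fundamental_theorem_of_calculus_interior)
    show "continuous_on {0..y} (\<lambda>x. - ((y - x) powr b / b))"
      using b by (intro continuous_intros continuous_on_powr'[OF _ continuous_on_const]) auto
    fix x assume "x \<in> {0<..<y}"
    then have x: "x < y" by auto
    then have "((\<lambda>x. - ((y - x) powr b / b)) has_real_derivative (y - x) powr (b - 1)) (at x)"
      using b by (auto intro!: derivative_eq_intros simp: powr_diff)
    then show "((\<lambda>x. - ((y - x) powr b / b)) has_vector_derivative \<bar>x - y\<bar> powr (b - 1)) (at x)"
      using x by (simp add: has_real_derivative_iff_has_vector_derivative abs_minus_commute[of x])
  qed (use y in auto)
  moreover have "((\<lambda>x. \<bar>x - y\<bar> powr (b - 1)) has_integral ((1 - y) powr b / b - (y - y) powr b / b)) {y..1}"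
  proof (rule fundamental_theorem_of_calculus_interior)
    show "continuous_on {y..1} (\<lambda>x. (x - y) powr b / b)"
      using b by (intro continuous_intros continuous_on_powr'[OF _ continuous_on_const]) auto
    fix x assume "x \<in> {y<..<1}"
    then have x: "x > y" by auto
    then have "((\<lambda>x. (x - y) powr b / b) has_real_derivative (x - y) powr (b - 1)) (at x)"
      using b by (auto intro!: derivative_eq_intros simp: powr_diff)
    then show "((\<lambda>x. (x - y) powr b / b) has_vector_derivative \<bar>x - y\<bar> powr (b - 1)) (at x)"
      using x by (simp add: has_real_derivative_iff_has_vector_derivative)
  qed (use y in auto)
  ultimately obtain v where v: "((\<lambda>x. \<bar>x - y\<bar> powr (b - 1)) has_integral v) {0..1}"
    using has_integral_combine[of 0 y 1] y by fastforce
  have "(cmod (complex_of_real (\<bar>x - y\<bar> powr (- \<theta>))))\<^sup>2 = \<bar>x - y\<bar> powr (b - 1)" for x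
    by (simp add: b_def power2_eq_square powr_add[symmetric])
  moreover have "integrable \<lambda>\<^sub>I (\<lambda>x. \<bar>x - y\<bar> powr (b - 1))"
    using v by (rule integrable_I_nonneg) simp
  moreover have "(\<lambda>x. complex_of_real (\<bar>x - y\<bar> powr (- \<theta>))) \<in> borel_measurable \<lambda>\<^sub>I"
    by (intro measurable_restrict_space1 measurable_completion) measurable
  ultimately show ?thesis
    by (simp add: square_integrable_def)
qed

subsection \<open>On the range of $u$\<close>

text \<open>The relation is indexed by numbers and has only nonzero coefficients, so that its
  largest index later identifies a leading term. A repeated vector is treated separately, because
  linear dependence of the set \<open>range b\<close> does not see repetitions.\<close>

lemma complex_dependent_sequence:
  fixes b :: "nat \<Rightarrow> 'a::complex_normed_vector"
  assumes "finite B" and "range b \<subseteq> complex_vector.span B"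
  obtains t c where "finite t" "t \<noteq> {}" "\<And>k. k \<in> t \<Longrightarrow> c k \<noteq> 0" "(\<Sum>k\<in>t. c k *\<^sub>C b k) = 0"
proof (cases "inj b")
  case False
  then obtain i j where "i \<noteq> j" "b i = b j"
    by (auto simp: inj_def)
  then show ?thesis
    by (intro that[of "{i, j}" "\<lambda>k. if k = i then 1 else - 1"]) auto
next
  case True
  then have "infinite (range b)"
    using finite_imageD infinite_UNIV_nat by blast
  then have "complex_vector.dependent (range b)"
    using complex_vector.independent_span_bound[OF assms(1) _ assms(2)] by blast
  then obtain s u where s: "finite s" "s \<subseteq> range b" "(\<Sum>v\<in>s. u v *\<^sub>C v) = 0" "\<exists>v\<in>s. u v \<noteq> 0"
    unfolding complex_vector.dependent_explicit by blast
  \<comment> \<open>Indices with coefficient zero are discarded; some index survives because the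
    relation is nontrivial.\<close>
  define t where "t = {k. b k \<in> s \<and> u (b k) \<noteq> 0}"
  have img: "b ` t = {v \<in> s. u v \<noteq> 0}"
    using s(2) by (auto simp: t_def)
  have inj: "inj_on b t"
    using True by (auto simp: inj_on_def)
  show ?thesis
  proof (rule that)
    show "finite t"
      using s(1) inj by (intro finite_imageD[of b t]) (auto simp: img)
    show "t \<noteq> {}"
      using img s(4) by blast
    show "u (b k) \<noteq> 0" if "k \<in> t" for k
      using that by (simp add: t_def)
    have "(\<Sum>k\<in>t. u (b k) *\<^sub>C b k) = (\<Sum>v\<in>b ` t. u v *\<^sub>C v)"
      by (simp add: sum.reindex[OF inj])
    also have "\<dots> = (\<Sum>v\<in>s. u v *\<^sub>C v)"
      unfolding img using s(1) by (intro sum.mono_neutral_left) auto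
    finally show "(\<Sum>k\<in>t. u (b k) *\<^sub>C b k) = 0"
      using s(3) by simp
  qed
qed

section \<open>Pointwise representatives of classes in L^2(I)\<close>

lemma AE_rep_abs_L2:
  assumes "square_integrable f"
  shows "AE x in \<lambda>\<^sub>I. rep_L2_I (abs_L2_I f) x = f x"
proof -
  have "L2_eq f f"
    using assms by (simp add: L2_eq_def)
  then have "L2_eq (rep_L2_I (abs_L2_I f)) f"
    by (rule Quotient_rep_abs[OF Quotient_L2_I])
  then show ?thesis
    by (simp add: L2_eq_def)
qed

lemma square_integrable_rep: "square_integrable (rep_L2_I F)"
  using Quotient_rep_reflp[OF Quotient_L2_I, of F] by (simp add: L2_eq_def)

lemma abs_rep_L2: "abs_L2_I (rep_L2_I F) = F"
  by (rule Quotient_abs_rep[OF Quotient_L2_I])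

lemma L2_eq_rep: "L2_eq (rep_L2_I F) (rep_L2_I F)"
  by (rule Quotient_rep_reflp[OF Quotient_L2_I])

lemma rep_L2_add: "AE x in \<lambda>\<^sub>I. rep_L2_I (F + G) x = rep_L2_I F x + rep_L2_I G x"
  using AE_rep_abs_L2[OF square_integrable_add[OF square_integrable_rep square_integrable_rep], of F G]
    plus_L2_I.abs_eq[OF L2_eq_rep L2_eq_rep, of F G]
  by (simp add: abs_rep_L2)

lemma rep_L2_scaleC: "AE x in \<lambda>\<^sub>I. rep_L2_I (z *\<^sub>C F) x = z * rep_L2_I F x"
  using AE_rep_abs_L2[OF square_integrable_scale[OF square_integrable_rep], of z F]
    scaleC_L2_I.abs_eq[OF L2_eq_rep, of z F]
  by (simp add: abs_rep_L2)

lemma rep_L2_mult: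
  assumes "ess_bounded a"
  shows "AE x in \<lambda>\<^sub>I. rep_L2_I (mult_L2 a F) x = complex_of_real (a x) * rep_L2_I F x"
  using AE_rep_abs_L2[OF square_integrable_mult[OF square_integrable_rep assms], of F]
    mult_L2.abs_eq[OF L2_eq_rep, of a F] assms
  by (simp add: abs_rep_L2)

lemma rep_L2_const: "AE x in \<lambda>\<^sub>I. rep_L2_I (const_L2 z) x = z"
  using AE_rep_abs_L2[OF square_integrable_const[of z]] by (simp add: const_L2.abs_eq)

lemma rep_L2_zero: "AE x in \<lambda>\<^sub>I. rep_L2_I 0 x = 0"
  using AE_rep_abs_L2[OF square_integrable_const[of 0]] by (simp add: zero_L2_I.abs_eq)

lemma rep_L2_sum_scaleC:
  assumes "finite t"
  shows "AE x in \<lambda>\<^sub>I. rep_L2_I (\<Sum>k\<in>t. c k *\<^sub>C F k) x = (\<Sum>k\<in>t. c k * rep_L2_I (F k) x)"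
  using assms
proof induction
  case empty
  show ?case using rep_L2_zero by simp
next
  case (insert k t)
  have "AE x in \<lambda>\<^sub>I. rep_L2_I (c k *\<^sub>C F k + (\<Sum>k\<in>t. c k *\<^sub>C F k)) x
      = c k * rep_L2_I (F k) x + (\<Sum>k\<in>t. c k * rep_L2_I (F k) x)"
    using rep_L2_add[of "c k *\<^sub>C F k" "\<Sum>k\<in>t. c k *\<^sub>C F k"] rep_L2_scaleC[of "c k" "F k"] insert.IH
    by eventually_elim simp
  with insert show ?case by simp
qed

text \<open>Near \<open>s = 0\<close> the combination is dominated by its steepest term.\<close>

lemma powr_combination_ge:
  fixes c :: "nat \<Rightarrow> complex" and \<theta> :: "nat \<Rightarrow> real"
  assumes t: "finite t" "t \<noteq> {}" and c: "\<And>k. k \<in> t \<Longrightarrow> c k \<noteq> 0"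
    and \<theta>: "strict_mono \<theta>" "\<And>k. \<theta> k > 1/4"
  obtains \<delta> \<epsilon> where "\<delta> > 0" "\<epsilon> > 0"
    "\<And>s. 0 < s \<Longrightarrow> s < \<delta> \<Longrightarrow>
      \<epsilon> * s powr (-1/4) \<le> cmod ((\<Sum>k\<in>t. c k * complex_of_real (s powr (- \<theta> k))) - m)"
proof -
  define N where "N = Max t"
  have N: "N \<in> t" and N_max: "\<And>k. k \<in> t \<Longrightarrow> k \<le> N"
    using t by (auto simp: N_def)
  \<comment> \<open>\<open>Q\<close> is the combination divided by its steepest power. All exponents
    become positive except that of the term \<open>N\<close>, so \<open>Q\<close> tends to
    \<open>c N\<close> at 0.\<close>
  define Q where "Q s = (\<Sum>k\<in>t. c k * complex_of_real (s powr (\<theta> N - \<theta> k)))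
      - m * complex_of_real (s powr \<theta> N)" for s
  have lim: "((\<lambda>s. s powr a) \<longlongrightarrow> 0) (at_right 0)" if "a > 0" for a :: real
    by (rule tendsto_zero_powrI[where b = a])
      (use that in \<open>auto intro: tendsto_ident_at eventually_at_right_less[THEN eventually_mono]\<close>)
  have "((\<lambda>s. c k * complex_of_real (s powr (\<theta> N - \<theta> k))) \<longlongrightarrow> (if k = N then c N else 0))
      (at_right 0)" if "k \<in> t" for k
  proof (cases "k = N")
    case True
    have "\<forall>\<^sub>F s in at_right 0. c k * complex_of_real (s powr (\<theta> N - \<theta> k)) = c N"
      using eventually_at_right_less[of "0::real"] by eventually_elim (use True in auto)
    then show ?thesis
      using True by (simp add: tendsto_eventually)
  next
    case False
    then have "k < N"
      using N_max[OF that] by simp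
    then have "\<theta> N - \<theta> k > 0"
      using strict_monoD[OF \<theta>(1)] by simp
    then have "((\<lambda>s. c k * complex_of_real (s powr (\<theta> N - \<theta> k))) \<longlongrightarrow> c k * complex_of_real 0)
        (at_right 0)"
      by (intro tendsto_intros lim)
    with False show ?thesis by simp
  qed
  then have "((\<lambda>s. \<Sum>k\<in>t. c k * complex_of_real (s powr (\<theta> N - \<theta> k)))
      \<longlongrightarrow> (\<Sum>k\<in>t. if k = N then c N else 0)) (at_right 0)"
    by (rule tendsto_sum)
  moreover have "((\<lambda>s. m * complex_of_real (s powr \<theta> N)) \<longlongrightarrow> m * complex_of_real 0) (at_right 0)"
    using \<theta>(2)[of N] by (intro tendsto_intros lim) simp
  ultimately have "(Q \<longlongrightarrow> (\<Sum>k\<in>t. if k = N then c N else 0) - m * complex_of_real 0) (at_right 0)"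
    unfolding Q_def by (rule tendsto_diff)
  then have "((\<lambda>s. cmod (Q s)) \<longlongrightarrow> cmod (c N)) (at_right 0)"
    using t N by (intro tendsto_norm) simp
  moreover have "cmod (c N) / 2 < cmod (c N)"
    using c[OF N] by simp
  ultimately have "\<forall>\<^sub>F s in at_right 0. cmod (c N) / 2 < cmod (Q s)"
    by (rule order_tendstoD(1))
  then obtain d where d: "d > 0" "\<And>s. 0 < s \<Longrightarrow> s < d \<Longrightarrow> cmod (c N) / 2 < cmod (Q s)"
    unfolding eventually_at_right_field by auto
  show ?thesis
  \<comment> \<open>Keeping \<open>s\<close> below 1 makes the steeper power the larger one when it
    is compared with \<open>s powr (-1/4)\<close>.\<close>
  proof (rule that[of "min d 1" "cmod (c N) / 2"])
    fix s :: real
    assume s: "0 < s" "s < min d 1"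
    have p: "complex_of_real (s powr (- \<theta> N)) * (z * complex_of_real (s powr a))
        = z * complex_of_real (s powr (a - \<theta> N))" for z a
      by (simp add: mult.left_commute[of _ z] powr_add[symmetric] flip: of_real_mult)
    have "complex_of_real (s powr (- \<theta> N)) * Q s
        = (\<Sum>k\<in>t. c k * complex_of_real (s powr (- \<theta> k))) - m"
      unfolding Q_def right_diff_distrib sum_distrib_left p using s(1) by simp
    from this[symmetric] have eq: "cmod ((\<Sum>k\<in>t. c k * complex_of_real (s powr (- \<theta> k))) - m)
        = s powr (- \<theta> N) * cmod (Q s)"
      by (simp add: norm_mult)
    have "s powr (-1/4) \<le> s powr (- \<theta> N)"
      using s \<theta>(2)[of N] by (intro powr_mono') auto
    then have "s powr (-1/4) * (cmod (c N) / 2) \<le> s powr (- \<theta> N) * cmod (Q s)"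
      using s d(2)[of s] by (intro mult_mono) auto
    then show "cmod (c N) / 2 * s powr (-1/4)
        \<le> cmod ((\<Sum>k\<in>t. c k * complex_of_real (s powr (- \<theta> k))) - m)"
      by (simp add: eq mult.commute)
  qed (use d c[OF N] in auto)
qed

text \<open>Infinitely many test vectors are reduced modulo the range to vectors in the span of
  \<open>B\<close>, so some combination of them lies in the range. They sit in the second component
  because the second row is a constant plus a multiple of \<open>w\<close>, whereas the first also
  contains a term with \<open>H\<close>. Near \<open>y\<close> the combination is at least of order
  s^(-1/4) and \<open>w\<close> at most of order s^(1/4), so the factor multiplying \<open>w\<close>
  is at least of order s^(-1/2), which is not square integrable.\<close>

lemma range_A0_not_cofinite:
  assumes w: "ess_bounded w" and H: "ess_bounded H" and y: "y \<in> {0..1}"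
    and small: "\<And>x. x \<in> {0..1} \<Longrightarrow> \<bar>w x\<bar> \<le> K * \<bar>x - y\<bar> powr (1/4)"
    and B: "finite B"
  shows "complex_vector.span (range (A0 g w H) \<union> B) \<noteq> UNIV"
proof
  assume span: "complex_vector.span (range (A0 g w H) \<union> B) = UNIV"
  define T where "T = A0 g w H"
  have T: "bounded_linear T" "\<And>a x. T (a *\<^sub>C x) = a *\<^sub>C T x"
    using bounded_clinear_A0[OF w H, of g] unfolding T_def bounded_clinear_def by blast+
  note T_lin = bounded_linear.linear[OF T(1)]
  have sub: "complex_vector.subspace (range T)"
  proof (rule complex_vector.subspaceI)
    show "0 \<in> range T"
      using linear_0[OF T_lin] by (metis rangeI)
    show "x + y \<in> range T" if "x \<in> range T" "y \<in> range T" for x y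
      using that linear_add[OF T_lin] by (metis (no_types, lifting) imageE rangeI)
    show "c *\<^sub>C x \<in> range T" if "x \<in> range T" for c x
      using that T(2) by (metis (no_types, lifting) imageE rangeI)
  qed
  \<comment> \<open>The values increase from 3/10 towards 1/2: below 1/2 for square integrability,
    above 1/4 for the lower bound at \<open>y\<close>, and distinct so that one power
    dominates.\<close>
  define \<theta> :: "nat \<Rightarrow> real" where "\<theta> k = 1/2 - 1 / (real k + 5)" for k
  have \<theta>: "strict_mono \<theta>" "\<And>k. \<theta> k > 1/4" "\<And>k. \<theta> k < 1/2"
    by (auto simp: \<theta>_def strict_mono_def field_simps)
  define f where "f k = (\<lambda>x. complex_of_real (\<bar>x - y\<bar> powr (- \<theta> k)))" for k
  have f: "square_integrable (f k)" for k
    unfolding f_def by (rule square_integrable_powr[OF y \<theta>(3)])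
  define P where "P k = abs_L2_I (f k)" for k
  have "\<exists>a b. b \<in> complex_vector.span B \<and> (0, P k) = T a + b" for k
  proof -
    have "(0, P k) \<in> complex_vector.span (range T \<union> B)"
      using span by (simp add: T_def)
    then show ?thesis
      unfolding complex_vector.span_Un complex_vector.span_eq_iff[THEN iffD2, OF sub] by blast
  qed
  then obtain a b where b: "\<And>k. b k \<in> complex_vector.span B" and ab: "\<And>k. (0, P k) = T (a k) + b k"
    by metis
  obtain t c where t: "finite t" "t \<noteq> {}" "\<And>k. k \<in> t \<Longrightarrow> c k \<noteq> 0"
    and sum0: "(\<Sum>k\<in>t. c k *\<^sub>C b k) = 0"
    using complex_dependent_sequence[OF B, of b] b by blast
  define \<phi> where "\<phi> = (\<Sum>k\<in>t. c k *\<^sub>C a k)"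
  have "(\<Sum>k\<in>t. c k *\<^sub>C (0, P k)) = (\<Sum>k\<in>t. c k *\<^sub>C T (a k)) + (\<Sum>k\<in>t. c k *\<^sub>C b k)"
    by (simp only: ab scaleC_add_right sum.distrib)
  also have "\<dots> = T \<phi>"
    by (simp add: sum0 \<phi>_def linear_sum[OF T_lin] T(2))
  finally have "snd (\<Sum>k\<in>t. c k *\<^sub>C ((0::L2_I), P k)) = snd (T \<phi>)"
    by simp
  then have snd_eq: "(\<Sum>k\<in>t. c k *\<^sub>C P k)
      = const_L2 (complex_of_real g * integral_L2 (fst \<phi>)) + mult_L2 w (snd \<phi>)"
    by (simp add: snd_sum scaleC_prod_def T_def A0_def case_prod_unfold)
  define m where "m = complex_of_real g * integral_L2 (fst \<phi>)"
  define \<psi> where "\<psi> = rep_L2_I (snd \<phi>)"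
  have "AE x in \<lambda>\<^sub>I. (\<Sum>k\<in>t. c k * rep_L2_I (P k) x) = m + complex_of_real (w x) * \<psi> x"
    using rep_L2_sum_scaleC[OF t(1), of c P] rep_L2_const[of m] rep_L2_mult[OF w, of "snd \<phi>"]
      rep_L2_add[of "const_L2 m" "mult_L2 w (snd \<phi>)"]
    unfolding snd_eq m_def[symmetric] \<psi>_def
    by eventually_elim simp
  moreover have "AE x in \<lambda>\<^sub>I. \<forall>k\<in>t. rep_L2_I (P k) x = f k x"
    using t(1) AE_rep_abs_L2[OF f] by (simp add: AE_finite_all P_def)
  ultimately have eq: "AE x in \<lambda>\<^sub>I. (\<Sum>k\<in>t. c k * f k x) - m = complex_of_real (w x) * \<psi> x"
    by eventually_elim simp
  obtain \<delta> \<epsilon> where \<delta>: "\<delta> > 0" and \<epsilon>: "\<epsilon> > 0" and lower: "\<And>s. 0 < s \<Longrightarrow> s < \<delta> \<Longrightarrow>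
      \<epsilon> * s powr (-1/4) \<le> cmod ((\<Sum>k\<in>t. c k * complex_of_real (s powr (- \<theta> k))) - m)"
    using powr_combination_ge[of t c \<theta> m, OF t \<theta>(1,2)] by blast
  \<comment> \<open>No sign is known for \<open>K\<close>, and the constant is divided by
    below.\<close>
  define K' where "K' = max K 1"
  have K': "K' > 0" "\<And>x. x \<in> {0..1} \<Longrightarrow> \<bar>w x\<bar> \<le> K' * \<bar>x - y\<bar> powr (1/4)"
    using order_trans[OF small mult_right_mono] by (auto simp: K'_def)
  have "\<not> integrable \<lambda>\<^sub>I (\<lambda>x. (cmod (\<psi> x))\<^sup>2)"
  proof (rule not_integrable_inverse_distance[OF _ y _ \<delta>])
    show "(\<epsilon> / K')\<^sup>2 > 0"
      using \<epsilon> K' by simp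
    have "AE x in \<lambda>\<^sub>I. x \<in> {0..1}"
      by (rule AE_I2) (simp add: space_restrict_space)
    then show "AE x in \<lambda>\<^sub>I. 0 < \<bar>x - y\<bar> \<and> \<bar>x - y\<bar> < \<delta> \<longrightarrow> (\<epsilon> / K')\<^sup>2 / \<bar>x - y\<bar> \<le> (cmod (\<psi> x))\<^sup>2"
      using eq
    proof eventually_elim
      case (elim x)
      show ?case
      proof
        assume s: "0 < \<bar>x - y\<bar> \<and> \<bar>x - y\<bar> < \<delta>"
        define s where "s = \<bar>x - y\<bar>"
        have s0: "s > 0" using s by (simp add: s_def)
        have "\<epsilon> * s powr (-1/4) \<le> \<bar>w x\<bar> * cmod (\<psi> x)"
          using lower[of s] s elim(2) by (simp add: s_def f_def norm_mult)
        also have "\<dots> \<le> (K' * s powr (1/4)) * cmod (\<psi> x)"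
          using K'(2)[OF elim(1)] by (intro mult_right_mono) (auto simp: s_def)
        \<comment> \<open>The extra factor \<open>s powr (-1/4)\<close> cancels the bound on
          \<open>w\<close> and leaves the exponent -1/2, whose square is 1/s.\<close>
        finally have "\<epsilon> * s powr (-1/4) * s powr (-1/4) \<le> (K' * s powr (1/4)) * cmod (\<psi> x) * s powr (-1/4)"
          by (rule mult_right_mono) simp
        also have "\<dots> = K' * cmod (\<psi> x) * (s powr (1/4) * s powr (-1/4))"
          by (simp only: mult_ac)
        also have "s powr (1/4) * s powr (-1/4) = 1"
          using s0 by (simp add: powr_add[symmetric])
        finally have "\<epsilon> * s powr (-1/2) \<le> K' * cmod (\<psi> x)"
          by (simp add: mult.assoc powr_add[symmetric])
        then have "\<epsilon> / K' * s powr (-1/2) \<le> cmod (\<psi> x)"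
          using K'(1) by (simp add: field_simps)
        then have "(\<epsilon> / K' * s powr (-1/2))\<^sup>2 \<le> (cmod (\<psi> x))\<^sup>2"
          using \<epsilon> K'(1) by (intro power_mono) auto
        moreover have "(s powr (-1/2))\<^sup>2 = 1 / s"
          using s0 by (simp add: power2_eq_square powr_add[symmetric] powr_minus_divide)
        ultimately show "(\<epsilon> / K')\<^sup>2 / \<bar>x - y\<bar> \<le> (cmod (\<psi> x))\<^sup>2"
          by (simp add: power_mult_distrib power_divide s_def mult.commute)
      qed
    qed
  qed simp
  then show False
    using square_integrable_rep[of "snd \<phi>"] by (simp add: square_integrable_def \<psi>_def)
qed

subsection \<open>Essential bounds of continuous functions\<close>

text \<open>\<open>ess_sup\<close> sends an infinite value to 0, so finiteness must be known before
  it can serve as a bound. The value minus infinity would make \<open>False\<close> hold almost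
  everywhere, which a probability space excludes.\<close>

lemma esssup_finite:
  assumes "ess_bounded f"
  shows "\<bar>esssup \<lambda>\<^sub>I (\<lambda>x. ereal (f x))\<bar> \<noteq> \<infinity>"
proof -
  have [measurable]: "f \<in> borel_measurable \<lambda>\<^sub>I"
    using assms by (auto simp: ess_bounded_def)
  obtain C where C: "AE x in \<lambda>\<^sub>I. \<bar>f x\<bar> \<le> C"
    using assms by (auto simp: ess_bounded_def)
  have "esssup \<lambda>\<^sub>I (\<lambda>x. ereal (f x)) \<le> ereal C"
    by (rule esssup_I) (use C in \<open>auto elim!: eventually_mono\<close>)
  moreover have "esssup \<lambda>\<^sub>I (\<lambda>x. ereal (f x)) \<noteq> - \<infinity>"
  proof
    assume "esssup \<lambda>\<^sub>I (\<lambda>x. ereal (f x)) = - \<infinity>"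
    then have "AE x in \<lambda>\<^sub>I. False"
      using esssup_AE[of "\<lambda>x. ereal (f x)" "\<lambda>\<^sub>I"] by simp
    then show False
      by (simp add: I_prob.AE_False)
  qed
  ultimately show ?thesis
    by auto
qed

lemma AE_le_ess_sup:
  assumes "ess_bounded f"
  shows "AE x in \<lambda>\<^sub>I. f x \<le> ess_sup \<lambda>\<^sub>I f"
proof -
  have "ereal (ess_sup \<lambda>\<^sub>I f) = esssup \<lambda>\<^sub>I (\<lambda>x. ereal (f x))"
    unfolding ess_sup_def by (rule ereal_real'[OF esssup_finite[OF assms]])
  then show ?thesis
    using esssup_AE[of "\<lambda>x. ereal (f x)" "\<lambda>\<^sub>I"] by (auto elim!: eventually_mono simp flip: ereal_less_eq(3))
qed

lemma ess_sup_le: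
  assumes "ess_bounded f" "AE x in \<lambda>\<^sub>I. f x \<le> c"
  shows "ess_sup \<lambda>\<^sub>I f \<le> c"
proof -
  have [measurable]: "f \<in> borel_measurable \<lambda>\<^sub>I"
    using assms by (auto simp: ess_bounded_def)
  have "ereal (ess_sup \<lambda>\<^sub>I f) = esssup \<lambda>\<^sub>I (\<lambda>x. ereal (f x))"
    unfolding ess_sup_def by (rule ereal_real'[OF esssup_finite[OF assms(1)]])
  moreover have "esssup \<lambda>\<^sub>I (\<lambda>x. ereal (f x)) \<le> ereal c"
    by (rule esssup_I) (use assms(2) in auto)
  ultimately show ?thesis
    by (metis ereal_less_eq(3))
qed

lemma ess_bounded_uminus: "ess_bounded f \<Longrightarrow> ess_bounded (\<lambda>x. - f x)"
  using ess_bounded_mult[OF ess_bounded_const[of "- 1"]] by simp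

lemma AE_ess_inf_le: "ess_bounded f \<Longrightarrow> AE x in \<lambda>\<^sub>I. ess_inf \<lambda>\<^sub>I f \<le> f x"
  using AE_le_ess_sup[OF ess_bounded_uminus, of f]
  by (auto simp: ess_inf_def elim!: eventually_mono)

text \<open>A violation at \<open>y\<close> would persist on a nonempty open interval, which is not
  a null set.\<close>

lemma AE_le_imp_le_continuous:
  fixes u :: "real \<Rightarrow> real"
  assumes cont: "continuous_on {0..1} u" and AE: "AE x in \<lambda>\<^sub>I. u x \<le> c" and y: "y \<in> {0..1}"
  shows "u y \<le> c"
proof (rule ccontr)
  assume "\<not> u y \<le> c"
  then have "u y - c > 0"
    by simp
  then obtain d where d: "d > 0" "\<And>x. x \<in> {0..1} \<Longrightarrow> dist x y < d \<Longrightarrow> dist (u x) (u y) < u y - c"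
    using cont y unfolding continuous_on_iff by blast
  \<comment> \<open>Intersecting with (0,1) matters because \<open>y\<close> may be an end
    point.\<close>
  define S where "S = {max 0 (y - d)<..<min 1 (y + d)}"
  have S: "x \<in> {0<..<1} \<and> u x > c" if "x \<in> S" for x
    using that d(2)[of x] by (auto simp: S_def dist_real_def abs_less_iff)
  have "AE x in lebesgue. x \<in> {0<..<1} \<longrightarrow> u x \<le> c"
    using AE by (simp add: AE_restrict_space_iff)
  then have "AE x in lebesgue. x \<notin> S"
    by eventually_elim (use S in force)
  then have "negligible S"
    by (simp add: negligible_iff_null_sets AE_iff_null_sets S_def)
  moreover have "max 0 (y - d) < min 1 (y + d)"
    using y d(1) by auto
  then have "S \<noteq> {}"
    unfolding S_def greaterThanLessThan_empty_iff by linarith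
  then have "\<not> negligible S"
    by (intro open_not_negligible) (auto simp: S_def)
  ultimately show False
    by contradiction
qed

text \<open>Makes the essential bound a genuine maximum, attained at a point at which the Hoelder
  condition can be applied.\<close>

lemma ess_sup_continuous:
  assumes cont: "continuous_on {0..1} u" and u: "ess_bounded u"
  shows "\<And>x. x \<in> {0..1} \<Longrightarrow> u x \<le> ess_sup \<lambda>\<^sub>I u" and "\<exists>x\<in>{0..1}. u x = ess_sup \<lambda>\<^sub>I u"
proof -
  show *: "u x \<le> ess_sup \<lambda>\<^sub>I u" if "x \<in> {0..1}" for x
    by (rule AE_le_imp_le_continuous[OF cont AE_le_ess_sup[OF u] that])
  obtain x where x: "x \<in> {0..1}" "\<And>z. z \<in> {0..1} \<Longrightarrow> u z \<le> u x"
    using continuous_attains_sup[OF _ _ cont] by force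
  have "AE z in \<lambda>\<^sub>I. u z \<le> u x"
    by (rule AE_I2) (use x(2) in \<open>simp add: space_restrict_space\<close>)
  then have "ess_sup \<lambda>\<^sub>I u \<le> u x"
    by (rule ess_sup_le[OF u])
  then show "\<exists>x\<in>{0..1}. u x = ess_sup \<lambda>\<^sub>I u"
    using *[OF x(1)] x(1) by (auto intro: antisym)
qed

lemma ess_inf_continuous:
  assumes cont: "continuous_on {0..1} u" and u: "ess_bounded u"
  shows "\<And>x. x \<in> {0..1} \<Longrightarrow> ess_inf \<lambda>\<^sub>I u \<le> u x" and "\<exists>x\<in>{0..1}. u x = ess_inf \<lambda>\<^sub>I u"
proof -
  have "continuous_on {0..1} (\<lambda>x. - u x)"
    by (intro continuous_intros cont)
  note * = ess_sup_continuous[OF this ess_bounded_uminus[OF u]]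
  show "ess_inf \<lambda>\<^sub>I u \<le> u x" if "x \<in> {0..1}" for x
    using *(1)[OF that] by (simp add: ess_inf_def)
  show "\<exists>x\<in>{0..1}. u x = ess_inf \<lambda>\<^sub>I u"
    using *(2) by (metis ess_inf_def minus_minus)
qed

section \<open>Hoelder continuous functions\<close>

lemma holder_on_continuous:
  assumes "holder_on S \<alpha> K u" "\<alpha> > 0" "K > 0"
  shows "continuous_on S u"
  unfolding continuous_on_def
proof
  fix x
  assume x: "x \<in> S"
  have "((\<lambda>z. K * \<bar>z - x\<bar> powr \<alpha>) \<longlongrightarrow> K * 0) (at x within S)"
    by (intro tendsto_mult tendsto_const tendsto_zero_powrI[where b = \<alpha>] tendsto_rabs_zero
        LIM_zero tendsto_ident_at assms) simp
  then have lim: "((\<lambda>z. K * \<bar>z - x\<bar> powr \<alpha>) \<longlongrightarrow> 0) (at x within S)"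
    by simp
  have "\<forall>\<^sub>F z in at x within S. norm (u z - u x) \<le> K * \<bar>z - x\<bar> powr \<alpha>"
    using assms(1) x by (auto simp: holder_on_def eventually_at_filter)
  then have "((\<lambda>z. u z - u x) \<longlongrightarrow> 0) (at x within S)"
    using lim by (rule Lim_null_comparison)
  then show "(u \<longlongrightarrow> u x) (at x within S)"
    by (rule LIM_zero_cancel)
qed

text \<open>Distances in [0,1] are at most one, so lowering the exponent keeps the constant.\<close>

lemma holder_on_mono:
  assumes "holder_on {0..1} \<beta> K u" "\<alpha> \<le> \<beta>" "K > 0"
  shows "holder_on {0..1} \<alpha> K u"
  unfolding holder_on_def
proof (intro ballI)
  fix x y :: real
  assume "x \<in> {0..1}" "y \<in> {0..1}"
  then have "\<bar>u x - u y\<bar> \<le> K * \<bar>x - y\<bar> powr \<beta>" "\<bar>x - y\<bar> powr \<beta> \<le> \<bar>x - y\<bar> powr \<alpha>"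
    using assms by (auto simp: holder_on_def intro!: powr_mono')
  then show "\<bar>u x - u y\<bar> \<le> K * \<bar>x - y\<bar> powr \<alpha>"
    using assms(3) by (meson mult_left_mono order_trans less_imp_le)
qed

subsection \<open>The scalar equation below the range\<close>

lemma ess_bounded_dispersion:
  assumes u: "ess_bounded u" and H: "ess_bounded H" and a: "\<And>x. x \<in> {0..1} \<Longrightarrow> a \<le> u x" and c: "c < a"
  shows "ess_bounded (\<lambda>x. H x / (u x - c)\<^sup>2)"
proof -
  have "ess_bounded (\<lambda>x. inverse (u x - c))"
  proof (rule ess_bounded_inverse)
    show "AE x in \<lambda>\<^sub>I. a - c \<le> \<bar>u x - c\<bar>"
    proof (rule AE_I2)
      fix x assume "x \<in> space \<lambda>\<^sub>I"
      then have "x \<in> {0..1}" by (simp add: space_restrict_space)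
      then show "a - c \<le> \<bar>u x - c\<bar>" using a[of x] c by auto
    qed
  qed (use c ess_bounded_diff_const[OF u] in \<open>auto simp: ess_bounded_def\<close>)
  then have "ess_bounded (\<lambda>x. H x * (inverse (u x - c) * inverse (u x - c)))"
    by (intro ess_bounded_mult H)
  then show ?thesis
    by (simp add: divide_inverse power2_eq_square)
qed

text \<open>Only parameters below the range are treated. Those above are reached by replacing
  \<open>u\<close> and \<open>c\<close> by their negatives, so \<open>a\<close> stands for either
  the minimum of \<open>u\<close> or minus its maximum.\<close>

locale lower_branch =
  fixes u H :: "real \<Rightarrow> real" and a i :: real
  assumes u: "ess_bounded u" and H: "ess_bounded H"
    and a: "\<And>x. x \<in> {0..1} \<Longrightarrow> a \<le> u x"
    and i: "i > 0" "AE x in \<lambda>\<^sub>I. i \<le> H x"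
begin

definition F :: "real \<Rightarrow> real"
  where "F c = (\<integral>x. H x / (u x - c)\<^sup>2 \<partial>\<lambda>\<^sub>I)"

lemma AE_mem_I: "AE x in \<lambda>\<^sub>I. x \<in> {0..1}"
  by (rule AE_I2) (simp add: space_restrict_space)

lemma dispersion_integrable: "c < a \<Longrightarrow> integrable \<lambda>\<^sub>I (\<lambda>x. H x / (u x - c)\<^sup>2)"
  using a by (intro ess_bounded_integrable ess_bounded_dispersion[OF u H]) auto

lemma F_strict_mono:
  assumes "c < d" "d < a"
  shows "F c < F d"
  unfolding F_def
proof (rule I_prob.integral_less_AE_space)
  show "AE x in \<lambda>\<^sub>I. H x / (u x - c)\<^sup>2 < H x / (u x - d)\<^sup>2"
    using AE_mem_I i(2)
  proof eventually_elim
    case (elim x)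
    then have "0 < u x - d" "u x - d < u x - c"
      using assms a[of x] by auto
    then show ?case
      using elim(2) i(1) by (intro divide_strict_left_mono power_strict_mono mult_pos_pos zero_less_power) auto
  qed
qed (use assms I_prob.emeasure_space_1 in \<open>auto intro!: dispersion_integrable\<close>)

text \<open>On \<open>{..d}\<close> the integrand is largest at \<open>d\<close>, which gives one
  integrable majorant for dominated convergence.\<close>

lemma F_continuous:
  assumes "d < a"
  shows "continuous_on {..d} F"
proof (rule continuous_on_sequentiallyI)
  fix s c
  assume s: "\<forall>n. s n \<in> {..d}" "c \<in> {..d}" "s \<longlonglongrightarrow> c"
  have m: "(\<lambda>x. H x / (u x - z)\<^sup>2) \<in> borel_measurable \<lambda>\<^sub>I" if "z \<le> d" for z
    using dispersion_integrable[of z] that assms by auto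
  have "(\<lambda>n. (\<integral>x. H x / (u x - s n)\<^sup>2 \<partial>\<lambda>\<^sub>I)) \<longlonglongrightarrow> (\<integral>x. H x / (u x - c)\<^sup>2 \<partial>\<lambda>\<^sub>I)"
  proof (rule integral_dominated_convergence[where w = "\<lambda>x. H x / (u x - d)\<^sup>2"])
    show "integrable \<lambda>\<^sub>I (\<lambda>x. H x / (u x - d)\<^sup>2)"
      by (rule dispersion_integrable[OF assms])
    show "AE x in \<lambda>\<^sub>I. (\<lambda>n. H x / (u x - s n)\<^sup>2) \<longlonglongrightarrow> H x / (u x - c)\<^sup>2"
      using AE_mem_I
    proof eventually_elim
      case (elim x)
      then have "u x - c \<noteq> 0"
        using a[of x] assms s(2) by auto
      then show ?case
        by (intro tendsto_intros s(3)) auto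
    qed
    show "AE x in \<lambda>\<^sub>I. norm (H x / (u x - s n)\<^sup>2) \<le> H x / (u x - d)\<^sup>2" for n
      using AE_mem_I i(2)
    proof eventually_elim
      case (elim x)
      then have "0 < u x - d" "u x - d \<le> u x - s n"
        using assms a[of x] s(1) by auto
      then have "H x / (u x - s n)\<^sup>2 \<le> H x / (u x - d)\<^sup>2"
        using elim(2) i(1) by (intro divide_left_mono power_mono mult_pos_pos zero_less_power) auto
      then show ?case
        using elim(2) i(1) by simp
    qed
  qed (use m s in auto)
  then show "(\<lambda>n. F (s n)) \<longlonglongrightarrow> F c"
    by (simp add: F_def)
qed

lemma integral_H_pos: "0 < (\<integral>x. H x \<partial>\<lambda>\<^sub>I)"
proof -
  have "i = (\<integral>x. i \<partial>\<lambda>\<^sub>I)"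
    using I_prob.prob_space by simp
  also have "\<dots> \<le> (\<integral>x. H x \<partial>\<lambda>\<^sub>I)"
    by (intro integral_mono_AE i ess_bounded_integrable H ess_bounded_const)
  finally show ?thesis
    using i(1) by simp
qed

text \<open>At this parameter \<open>u - c\<close> is at least \<open>sqrt (g * h)\<close>. Equality
  occurs for constant \<open>u\<close>, so the end point has to belong to the interval containing
  the root.\<close>

lemma F_left_end:
  assumes "g > 0" and h: "h = (\<integral>x. H x \<partial>\<lambda>\<^sub>I)"
  shows "g * F (a - sqrt (g * h)) \<le> 1"
proof -
  have gh: "g * h > 0"
    using integral_H_pos assms by simp
  have "F (a - sqrt (g * h)) \<le> (\<integral>x. H x / (g * h) \<partial>\<lambda>\<^sub>I)"
    unfolding F_def
  proof (rule integral_mono_AE)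
    show "AE x in \<lambda>\<^sub>I. H x / (u x - (a - sqrt (g * h)))\<^sup>2 \<le> H x / (g * h)"
      using AE_mem_I i(2)
    proof eventually_elim
      case (elim x)
      have "(sqrt (g * h))\<^sup>2 \<le> (u x - (a - sqrt (g * h)))\<^sup>2"
        using a[OF elim(1)] gh by (intro power_mono) auto
      then show ?case
        using gh elim(2) i(1) by (intro frac_le) auto
    qed
  qed (use gh ess_bounded_integrable[OF H] in \<open>auto intro!: dispersion_integrable\<close>)
  also have "\<dots> = 1 / g"
    using gh by (auto simp flip: h)
  finally show ?thesis
    using assms(1) by (simp add: field_simps)
qed

text \<open>Away from the minimum point \<open>y\<close> the shift \<open>c = a - \<epsilon> K \<eta>\<^sup>\<alpha>\<close> changes the Hoelder bound on
  \<open>u - c\<close> only by the factor \<open>1 + \<epsilon>\<close>.\<close>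

lemma AE_dispersion_ge:
  assumes y: "y \<in> {0..1}" "u y = a" and holder: "holder_on {0..1} \<alpha> K u" "K > 0" "\<alpha> > 0"
    and pos: "\<epsilon> > 0" "\<eta> > 0"
  shows "AE x in \<lambda>\<^sub>I. \<eta> \<le> \<bar>x - y\<bar> \<longrightarrow>
    i / ((1 + \<epsilon>) * K)\<^sup>2 / (\<bar>x - y\<bar> powr \<alpha>)\<^sup>2 \<le> H x / (u x - (a - \<epsilon> * K * \<eta> powr \<alpha>))\<^sup>2"
  using AE_mem_I i(2)
proof eventually_elim
  case (elim x)
  show ?case
  proof
    assume s: "\<eta> \<le> \<bar>x - y\<bar>"
    have "u x - a \<le> K * \<bar>x - y\<bar> powr \<alpha>"
      using holder(1) y elim(1) unfolding holder_on_def by force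
    moreover have "\<epsilon> * K * \<eta> powr \<alpha> \<le> \<epsilon> * K * \<bar>x - y\<bar> powr \<alpha>"
      using s pos holder by (intro mult_left_mono powr_mono2) auto
    moreover have p: "0 < \<epsilon> * K * \<eta> powr \<alpha>"
      using pos holder by simp
    ultimately have *: "0 < u x - (a - \<epsilon> * K * \<eta> powr \<alpha>)"
      "u x - (a - \<epsilon> * K * \<eta> powr \<alpha>) \<le> (1 + \<epsilon>) * K * \<bar>x - y\<bar> powr \<alpha>"
      using a[OF elim(1)] by (auto simp: algebra_simps)
    then have "i / ((1 + \<epsilon>) * K * \<bar>x - y\<bar> powr \<alpha>)\<^sup>2 \<le> H x / (u x - (a - \<epsilon> * K * \<eta> powr \<alpha>))\<^sup>2"
      using elim(2) i(1) by (intro frac_le power_mono zero_less_power) auto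
    then show "i / ((1 + \<epsilon>) * K)\<^sup>2 / (\<bar>x - y\<bar> powr \<alpha>)\<^sup>2 \<le> H x / (u x - (a - \<epsilon> * K * \<eta> powr \<alpha>))\<^sup>2"
      by (simp add: power_mult_distrib)
  qed
qed

text \<open>The case \<epsilon> = 1 of \<open>AE_dispersion_ge\<close>: the squared Hoelder bound is
  linear in the distance, so the lower bound diverges logarithmically as \<eta> tends to 0.\<close>

lemma F_ge_log:
  assumes y: "y \<in> {0..1}" "u y = a" and holder: "holder_on {0..1} (1/2) K u" "K > 0" and \<eta>: "\<eta> > 0"
  shows "i / (2 * K)\<^sup>2 * (ln (1/2) - ln \<eta>) \<le> F (a - K * \<eta> powr (1/2))"
  unfolding F_def
proof (rule integral_ge_log[OF dispersion_integrable _ _ y(1) \<eta>])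
  show "a - K * \<eta> powr (1/2) < a"
    using holder \<eta> by simp
  show "AE x in \<lambda>\<^sub>I. 0 \<le> H x / (u x - (a - K * \<eta> powr (1/2)))\<^sup>2"
    using i(2) by eventually_elim (use i(1) in simp)
  have "(\<bar>x - y\<bar> powr (1/2))\<^sup>2 = \<bar>x - y\<bar>" for x
    by (simp add: powr_half_sqrt)
  then show "AE x in \<lambda>\<^sub>I. \<eta> \<le> \<bar>x - y\<bar> \<longrightarrow>
      i / (2 * K)\<^sup>2 / \<bar>x - y\<bar> \<le> H x / (u x - (a - K * \<eta> powr (1/2)))\<^sup>2"
    using AE_dispersion_ge[OF y holder _ _ \<eta>, of 1] by simp
qed (use i in simp)

text \<open>The squared Hoelder bound is now the square root of the distance, whose inverse is
  integrable, so the lower bound stays finite. Its limit as \<eta> and then \<epsilon> tend to 0 is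
  \<open>2 * i / K\<^sup>2\<close>; this is the source of the threshold on \<open>K\<close>.\<close>

lemma F_ge_sqrt:
  assumes y: "y \<in> {0..1}" "u y = a" and holder: "holder_on {0..1} (1/4) K u" "K > 0"
    and \<epsilon>: "\<epsilon> > 0" and \<eta>: "\<eta> > 0"
  shows "i / ((1 + \<epsilon>) * K)\<^sup>2 * (2 - 4 * sqrt \<eta>) \<le> F (a - \<epsilon> * K * \<eta> powr (1/4))"
proof -
  define A where "A = i / ((1 + \<epsilon>) * K)\<^sup>2"
  have A: "A \<ge> 0"
    using i by (simp add: A_def)
  have "(A * (2 * sqrt (max \<eta> y)) - A * (2 * sqrt \<eta>)) + (A * (2 * sqrt (max \<eta> (1 - y))) - A * (2 * sqrt \<eta>))
      \<le> F (a - \<epsilon> * K * \<eta> powr (1/4))"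
    unfolding F_def
  proof (rule integral_ge_radial[where G = "\<lambda>s. A / sqrt s", OF dispersion_integrable _ _ y(1) \<eta>])
    show "a - \<epsilon> * K * \<eta> powr (1/4) < a"
      using holder \<epsilon> \<eta> by simp
    show "AE x in \<lambda>\<^sub>I. 0 \<le> H x / (u x - (a - \<epsilon> * K * \<eta> powr (1/4)))\<^sup>2"
      using i(2) by eventually_elim (use i(1) in simp)
    have quarter: "0 < (1/4 :: real)" by simp
    have "(\<bar>x - y\<bar> powr (1/4))\<^sup>2 = sqrt \<bar>x - y\<bar>" for x
      by (simp add: powr_half_sqrt[symmetric] power2_eq_square powr_add[symmetric])
    then show "AE x in \<lambda>\<^sub>I. \<eta> \<le> \<bar>x - y\<bar> \<longrightarrow>
        A / sqrt \<bar>x - y\<bar> \<le> H x / (u x - (a - \<epsilon> * K * \<eta> powr (1/4)))\<^sup>2"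
      using AE_dispersion_ge[OF y holder quarter \<epsilon> \<eta>] unfolding A_def by (simp only:)
    show "((\<lambda>s. A * (2 * sqrt s)) has_real_derivative A / sqrt s) (at s)" if "s > 0" for s
    proof -
      have "A * (2 * (inverse (sqrt s) / 2)) = A / sqrt s"
        by (simp only: divide_inverse) simp
      then show ?thesis
        using DERIV_cmult[OF DERIV_cmult[OF DERIV_real_sqrt[OF that]], of A 2] by (simp only:)
    qed
  qed (use A in simp)
  \<comment> \<open>The sum of the square roots of \<open>y\<close> and \<open>1 - y\<close> is
    smallest at the end points, where it equals one.\<close>
  moreover have "1 \<le> sqrt (max \<eta> y) + sqrt (max \<eta> (1 - y))"
  proof -
    have "y \<le> sqrt y" "1 - y \<le> sqrt (1 - y)"
      using y(1) by (auto intro!: real_le_rsqrt power_le_one_iff simp: power2_eq_square mult_left_le)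
    moreover have "sqrt y \<le> sqrt (max \<eta> y)" "sqrt (1 - y) \<le> sqrt (max \<eta> (1 - y))"
      by auto
    ultimately show ?thesis by linarith
  qed
  then have "A * 1 \<le> A * (sqrt (max \<eta> y) + sqrt (max \<eta> (1 - y)))"
    by (rule mult_left_mono[OF _ A])
  ultimately show ?thesis
    unfolding A_def[symmetric] by (simp add: algebra_simps)
qed

lemma F_exceeds:
  assumes g: "g > 0" and y: "y \<in> {0..1}" "u y = a"
    and K: "K > 0" and "holder_on {0..1} (1/2) K u \<or> holder_on {0..1} (1/4) K u \<and> K < sqrt (2 * g * i)"
  shows "\<exists>c<a. g * F c > 1"
proof (rule ccontr)
  assume "\<not> ?thesis"
  then have le: "F c \<le> 1 / g" if "c < a" for c
    using that g by (force simp: field_simps not_less)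
  from assms(5) show False
  proof
    assume holder: "holder_on {0..1} (1/2) K u"
    define A where "A = i / (2 * K)\<^sup>2"
    have A: "A > 0"
      using i K by (simp add: A_def)
    \<comment> \<open>Chosen so that the logarithmic lower bound equals
      \<open>1 / g + A\<close>.\<close>
    define \<eta> where "\<eta> = exp (ln (1/2) - 1 / (g * A) - 1)"
    have "A * (ln (1/2) - ln \<eta>) \<le> 1 / g"
      using F_ge_log[OF y holder K, of \<eta>] le[of "a - K * \<eta> powr (1/2)"] K
      by (simp add: A_def \<eta>_def)
    moreover have "A * (ln (1/2) - ln \<eta>) = 1 / g + A"
      using A g by (simp add: \<eta>_def field_simps)
    ultimately show False
      using A by simp
  next
    assume holder: "holder_on {0..1} (1/4) K u \<and> K < sqrt (2 * g * i)"
    \<comment> \<open>Taking \<eta> to be the square of \<epsilon> leaves a single parameter;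
      letting it tend to 0 gives \<open>2 * g * i\<close> at most the square of
      \<open>K\<close>.\<close>
    have bound: "i * g * (2 - 4 * \<epsilon>) \<le> ((1 + \<epsilon>) * K)\<^sup>2" if \<epsilon>: "\<epsilon> > 0" for \<epsilon>
    proof -
      have "i / ((1 + \<epsilon>) * K)\<^sup>2 * (2 - 4 * sqrt (\<epsilon>\<^sup>2)) \<le> 1 / g"
        using F_ge_sqrt[OF y conjunct1[OF holder] K \<epsilon>, of "\<epsilon>\<^sup>2"]
          le[of "a - \<epsilon> * K * \<epsilon>\<^sup>2 powr (1/4)"] K \<epsilon> by simp
      then have "g * ((1 + \<epsilon>) * K)\<^sup>2 * (i / ((1 + \<epsilon>) * K)\<^sup>2 * (2 - 4 * \<epsilon>))
          \<le> g * ((1 + \<epsilon>) * K)\<^sup>2 * (1 / g)"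
        using g \<epsilon> by (intro mult_left_mono) auto
      then show ?thesis
        using g K \<epsilon> by (simp add: mult_ac)
    qed
    have lim: "((\<lambda>\<epsilon>. i * g * (2 - 4 * \<epsilon>)) \<longlongrightarrow> i * g * (2 - 4 * 0)) (at_right 0)"
      "((\<lambda>\<epsilon>. ((1 + \<epsilon>) * K)\<^sup>2) \<longlongrightarrow> ((1 + 0) * K)\<^sup>2) (at_right 0)"
      by (intro tendsto_intros)+
    have "\<forall>\<^sub>F \<epsilon> in at_right 0. i * g * (2 - 4 * \<epsilon>) \<le> ((1 + \<epsilon>) * K)\<^sup>2"
      using eventually_at_right_less[of "0::real"] by eventually_elim (rule bound)
    then have "i * g * (2 - 4 * 0) \<le> ((1 + 0) * K)\<^sup>2"
      by (rule tendsto_le[OF trivial_limit_at_right_real lim(2,1)])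
    moreover have "K\<^sup>2 < (sqrt (2 * g * i))\<^sup>2"
      using holder K by (intro power_strict_mono) auto
    ultimately show False
      using g i by (simp add: mult_ac)
  qed
qed

text \<open>Existence is the intermediate value theorem between the left end, where
  \<open>g * F\<close> is at most 1, and a point where it exceeds 1; uniqueness is strict
  monotonicity.\<close>

lemma unique_root:
  assumes g: "g > 0" and h: "h = (\<integral>x. H x \<partial>\<lambda>\<^sub>I)" and y: "y \<in> {0..1}" "u y = a"
    and K: "K > 0" and holder: "holder_on {0..1} (1/2) K u \<or> holder_on {0..1} (1/4) K u \<and> K < sqrt (2 * g * i)"
  shows "\<exists>c0\<in>{a - sqrt (g * h)..<a}. \<forall>c<a. g * F c = 1 \<longleftrightarrow> c = c0"
proof -
  let ?l = "a - sqrt (g * h)"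
  have l: "?l < a" "g * F ?l \<le> 1"
    using integral_H_pos g F_left_end[OF g h] by (auto simp: h)
  obtain c1 where c1: "c1 < a" "g * F c1 > 1"
    using F_exceeds[OF g y K holder] by blast
  have "g * F ?l < g * F c1"
    using l c1 by simp
  then have "?l \<le> c1"
    using F_strict_mono[of c1 ?l] l g by (force simp: not_le[symmetric])
  moreover have "continuous_on {?l..c1} (\<lambda>c. g * F c)"
    by (intro continuous_intros continuous_on_subset[OF F_continuous[OF c1(1)]]) auto
  ultimately obtain c0 where c0: "?l \<le> c0" "c0 \<le> c1" "g * F c0 = 1"
    using IVT'[of "\<lambda>c. g * F c" ?l 1 c1] l c1 by auto
  have "c = c0" if "c < a" "g * F c = 1" for c
  proof -
    have "F c = F c0"
      using that(2) c0(3) g by (metis mult_left_cancel less_irrefl)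
    then show ?thesis
      using F_strict_mono[of c c0] F_strict_mono[of c0 c] that c0 c1 by force
  qed
  then show ?thesis
    using c0 c1 by (intro bexI[of _ c0]) auto
qed

end

subsection \<open>The real spectrum\<close>

text \<open>The range of \<open>u\<close> is compact, so a point outside it has positive distance
  from it.\<close>

lemma off_range_shift:
  assumes cont: "continuous_on {0..1} u" and u: "ess_bounded u" and H: "ess_bounded H"
    and c: "c \<notin> u ` {0..1}"
  shows "off_range (\<lambda>x. u x - c) H"
proof -
  have "closed (u ` {0..1})"
    by (intro compact_imp_closed compact_continuous_image cont) simp
  then obtain d where d: "d > 0" "\<And>z. z \<in> u ` {0..1} \<Longrightarrow> d \<le> dist c z"
    using separate_point_closed[OF _ c] by blast
  have AE: "AE x in \<lambda>\<^sub>I. d \<le> \<bar>u x - c\<bar>"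
  proof (rule AE_I2)
    fix x assume "x \<in> space \<lambda>\<^sub>I"
    then have "x \<in> {0..1}" by (simp add: space_restrict_space)
    then show "d \<le> \<bar>u x - c\<bar>"
      using d(2)[of "u x"] by (simp add: dist_real_def abs_minus_commute)
  qed
  show ?thesis
  proof
    show w: "ess_bounded (\<lambda>x. u x - c)"
      by (rule ess_bounded_diff_const[OF u])
    show "ess_bounded (\<lambda>x. inverse (u x - c))"
      using w by (intro ess_bounded_inverse[OF _ d(1) AE]) (simp add: ess_bounded_def)
    show "AE x in \<lambda>\<^sub>I. u x - c \<noteq> 0"
      using AE by eventually_elim (use d in auto)
  qed (rule H)
qed

text \<open>The three notions agree off the range: if the dispersion relation fails the shifted
  operator is invertible, and if it holds the operator is Fredholm with a nontrivial kernel.\<close>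

lemma spectrum_off_range:
  assumes cont: "continuous_on {0..1} u" and u: "ess_bounded u" and H: "ess_bounded H"
    and c: "c \<notin> u ` {0..1}"
  shows "complex_of_real c \<in> op_spectrum (A0 g u H) \<longleftrightarrow> g * (\<integral>x. H x / (u x - c)\<^sup>2 \<partial>\<lambda>\<^sub>I) = 1"
    and "complex_of_real c \<in> discrete_spectrum (A0 g u H) \<longleftrightarrow> g * (\<integral>x. H x / (u x - c)\<^sup>2 \<partial>\<lambda>\<^sub>I) = 1"
    and "op_eigenvalue (A0 g u H) (complex_of_real c) \<longleftrightarrow> g * (\<integral>x. H x / (u x - c)\<^sup>2 \<partial>\<lambda>\<^sub>I) = 1"
proof -
  interpret off_range g "\<lambda>x. u x - c" H
    by (rule off_range_shift[OF assms])
  define T where "T = shift_op (A0 g u H) (complex_of_real c)"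
  have T: "T = A0 g (\<lambda>x. u x - c) H"
    unfolding T_def by (rule shift_op_A0[OF u])
  have q: "(\<integral>x. H x / (u x - c)\<^sup>2 \<partial>\<lambda>\<^sub>I) = q"
    by (simp add: q_def)
  have inv: "invertible_op T" if "g * q \<noteq> 1"
    unfolding T by (rule invertible_A0[OF that])
  have eig: "op_eigenvalue (A0 g u H) (complex_of_real c) \<longleftrightarrow> (\<exists>x. x \<noteq> 0 \<and> T x = 0)"
    by (simp add: op_eigenvalue_def T_def shift_op_def)
  have ex: "\<exists>x. x \<noteq> 0 \<and> T x = 0" if "g * q = 1"
    unfolding T by (rule nontrivial_kernel_A0[OF that])
  have not_inv: "\<not> invertible_op T" if "\<exists>x. x \<noteq> 0 \<and> T x = 0"
  proof
    assume "invertible_op T"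
    then obtain S where S: "S \<circ> T = id" and "bounded_clinear T"
      by (auto simp: invertible_op_def)
    then have "T 0 = 0"
      by (auto simp: bounded_clinear_def bounded_linear.linear linear_0)
    with that S show False
      by (metis comp_apply id_apply)
  qed
  show "complex_of_real c \<in> op_spectrum (A0 g u H) \<longleftrightarrow> g * (\<integral>x. H x / (u x - c)\<^sup>2 \<partial>\<lambda>\<^sub>I) = 1"
    using inv ex not_inv unfolding q op_spectrum_def T_def by blast
  show "op_eigenvalue (A0 g u H) (complex_of_real c) \<longleftrightarrow> g * (\<integral>x. H x / (u x - c)\<^sup>2 \<partial>\<lambda>\<^sub>I) = 1"
    using inv ex not_inv unfolding q eig by blast
  have "fredholm T" if "g * q = 1"
    unfolding T by (rule fredholm_A0[OF that])
  then show "complex_of_real c \<in> discrete_spectrum (A0 g u H) \<longleftrightarrow>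
      g * (\<integral>x. H x / (u x - c)\<^sup>2 \<partial>\<lambda>\<^sub>I) = 1"
    using inv ex not_inv unfolding q discrete_spectrum_def T_def by blast
qed

text \<open>Infinite codimension of the range excludes the Fredholm property, and with the empty set
  in place of \<open>B\<close> it excludes surjectivity.\<close>

lemma spectrum_on_range:
  assumes holder: "holder_on {0..1} (1/4) K u" and u: "ess_bounded u" and H: "ess_bounded H"
    and c: "c \<in> u ` {0..1}"
  shows "complex_of_real c \<in> op_spectrum (A0 g u H)"
    and "complex_of_real c \<notin> discrete_spectrum (A0 g u H)"
proof -
  obtain y where y: "y \<in> {0..1}" "c = u y"
    using c by blast
  define T where "T = shift_op (A0 g u H) (complex_of_real c)"
  have T: "T = A0 g (\<lambda>x. u x - c) H"
    unfolding T_def by (rule shift_op_A0[OF u])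
  have "\<bar>u x - c\<bar> \<le> K * \<bar>x - y\<bar> powr (1/4)" if "x \<in> {0..1}" for x
    using holder y that by (simp add: holder_on_def)
  then have span: "complex_vector.span (range T \<union> B) \<noteq> UNIV" if "finite B" for B
    unfolding T by (rule range_A0_not_cofinite[OF ess_bounded_diff_const[OF u] H y(1) _ that])
  then have "\<not> fredholm T"
    by (auto simp: fredholm_def)
  then show "complex_of_real c \<notin> discrete_spectrum (A0 g u H)"
    by (simp add: discrete_spectrum_def T_def)
  have "\<not> invertible_op T"
  proof
    assume "invertible_op T"
    then have "surj T"
      by (metis invertible_op_def comp_apply id_apply surjI)
    then show False
      using span[of "{}"] by (simp add: complex_vector.span_UNIV)
  qed
  then show "complex_of_real c \<in> op_spectrum (A0 g u H)"
    by (simp add: op_spectrum_def T_def)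
qed

theorem proposition4p7:
  fixes g h u_minus u_plus :: real and u H :: "real \<Rightarrow> real"
    and J_minus J_plus :: "real set"
  assumes "g > 0"
    and "ess_bounded u" and "ess_bounded H"
    and "ess_inf \<lambda>\<^sub>I H > 0"
    and "u_minus = ess_inf \<lambda>\<^sub>I u" and "u_plus = ess_sup \<lambda>\<^sub>I u"
    and "h = (\<integral>x. H x \<partial>\<lambda>\<^sub>I)"
    and "J_minus = {u_minus - sqrt (g * h) ..< u_minus}"
    and "J_plus = {u_plus <.. u_plus + sqrt (g * h)}"
    and "(\<exists>K>0. holder_on {0..1} (1/2) K u) \<or>
         (\<exists>K>0. holder_on {0..1} (1/4) K u \<and> K < sqrt (2 * g * ess_inf \<lambda>\<^sub>I H))"
  shows "\<exists>c_minus\<in>J_minus. \<exists>c_plus\<in>J_plus.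
    op_eigenvalue (A0 g u H) (complex_of_real c_minus) \<and>
    op_eigenvalue (A0 g u H) (complex_of_real c_plus) \<and>
    {c \<in> J_minus \<union> J_plus. op_eigenvalue (A0 g u H) (complex_of_real c)} = {c_minus, c_plus} \<and>
    op_spectrum (A0 g u H) \<inter> \<real> = complex_of_real ` ({c_minus, c_plus} \<union> u ` {0..1}) \<and>
    discrete_spectrum (A0 g u H) \<inter> \<real> = complex_of_real ` {c_minus, c_plus}"
proof -
  note g = assms(1) and u = assms(2) and H = assms(3) and h = assms(7)
  define i where "i = ess_inf \<lambda>\<^sub>I H"
  obtain K where K: "K > 0"
    and holder: "holder_on {0..1} (1/2) K u \<or> holder_on {0..1} (1/4) K u \<and> K < sqrt (2 * g * i)"
    using assms(10) by (auto simp: i_def)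
  have holder4: "holder_on {0..1} (1/4) K u"
    using holder holder_on_mono[of "1/2" K u "1/4"] K by auto
  have cont: "continuous_on {0..1} u"
    using holder_on_continuous[OF holder4 _ K] by simp
  have i: "i > 0" "AE x in \<lambda>\<^sub>I. i \<le> H x"
    using assms(4) AE_ess_inf_le[OF H] by (simp_all add: i_def)
  note inf = ess_inf_continuous[OF cont u, folded assms(5)]
  note sup = ess_sup_continuous[OF cont u, folded assms(6)]
  define D where "D c = g * (\<integral>x. H x / (u x - c)\<^sup>2 \<partial>\<lambda>\<^sub>I)" for c

  interpret minus: lower_branch u H u_minus i
    by standard (use u H inf(1) i in auto)
  obtain y where y: "y \<in> {0..1}" "u y = u_minus"
    using inf(2) by blast
  obtain c_minus where c_minus: "c_minus \<in> J_minus" "\<And>c. c < u_minus \<Longrightarrow> D c = 1 \<longleftrightarrow> c = c_minus"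
    using minus.unique_root[OF g h y K holder] unfolding assms(8) minus.F_def D_def by blast

  \<comment> \<open>Reflection: replacing \<open>u\<close> and \<open>c\<close> by their negatives
    leaves the square of \<open>u - c\<close> unchanged and turns the upper branch into a lower one.
    The root found there is negated to give \<open>c_plus\<close>.\<close>
  interpret plus: lower_branch "\<lambda>x. - u x" H "- u_plus" i
    by standard (use ess_bounded_uminus[OF u] H sup(1) i in auto)
  obtain z where z: "z \<in> {0..1}" "- u z = - u_plus"
    using sup(2) by auto
  have "holder_on {0..1} \<alpha> K (\<lambda>x. - u x)" if "holder_on {0..1} \<alpha> K u" for \<alpha>
    using that by (simp add: holder_on_def abs_minus_commute)
  then have "holder_on {0..1} (1/2) K (\<lambda>x. - u x) \<or>
      holder_on {0..1} (1/4) K (\<lambda>x. - u x) \<and> K < sqrt (2 * g * i)"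
    using holder by blast
  from plus.unique_root[OF g h z K this] obtain c' where
    c': "c' \<in> {- u_plus - sqrt (g * h)..<- u_plus}" "\<And>c. c < - u_plus \<Longrightarrow> g * plus.F c = 1 \<longleftrightarrow> c = c'"
    by blast
  have D: "D c = g * plus.F (- c)" for c
    unfolding D_def plus.F_def by (simp add: power2_commute)
  define c_plus where "c_plus = - c'"
  have c_plus: "c_plus \<in> J_plus" "\<And>c. u_plus < c \<Longrightarrow> D c = 1 \<longleftrightarrow> c = c_plus"
    using c'(1) c'(2)[of "- c" for c] by (auto simp: assms(9) c_plus_def D)

  \<comment> \<open>The range is a full interval, so a real number outside it lies below
    \<open>u_minus\<close> or above \<open>u_plus\<close>, where one of the two branches
    applies.\<close>
  have range: "u ` {0..1} = {u_minus..u_plus}"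
  proof
    have "connected (u ` {0..1})"
      by (intro connected_continuous_image cont) simp
    moreover have "u_minus \<in> u ` {0..1}" "u_plus \<in> u ` {0..1}"
      using inf(2) sup(2) by force+
    ultimately show "{u_minus..u_plus} \<subseteq> u ` {0..1}"
      by (rule connected_contains_Icc)
  qed (use inf(1) sup(1) in auto)
  have J: "c_minus < u_minus" "u_plus < c_plus" "c \<in> J_minus \<union> J_plus \<Longrightarrow> c \<notin> u ` {0..1}" for c
    using c_minus(1) c_plus(1) unfolding range assms(8,9) by auto
  have root: "D c = 1 \<longleftrightarrow> c = c_minus \<or> c = c_plus" if "c \<notin> u ` {0..1}" for c
  proof -
    have "u_minus \<le> u_plus"
      using inf(1)[OF y(1)] sup(1)[OF y(1)] by simp
    then show ?thesis
      using that c_minus(2)[of c] c_plus(2)[of c] J(1,2) unfolding range by force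
  qed
  note off = spectrum_off_range[OF cont u H, where g = g, folded D_def]
  note on = spectrum_on_range[OF holder4 u H, where g = g]
  have notin: "c_minus \<notin> u ` {0..1}" "c_plus \<notin> u ` {0..1}"
    using c_minus(1) c_plus(1) J(3) by auto
  have spectrum: "complex_of_real c \<in> op_spectrum (A0 g u H) \<longleftrightarrow> c \<in> {c_minus, c_plus} \<union> u ` {0..1}" for c
    using off(1) on(1) root by blast
  have discrete: "complex_of_real c \<in> discrete_spectrum (A0 g u H) \<longleftrightarrow> c \<in> {c_minus, c_plus}" for c
  proof (cases "c \<in> u ` {0..1}")
    case True
    then show ?thesis
      using on(2)[OF True] notin by auto
  next
    case False
    then show ?thesis
      using off(2)[OF False] root[OF False] by simp
  qed
  have eigenvalue: "op_eigenvalue (A0 g u H) (complex_of_real c) \<longleftrightarrow> c \<in> {c_minus, c_plus}"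
    if "c \<in> J_minus \<union> J_plus" for c
    using off(3)[OF J(3)[OF that]] root[OF J(3)[OF that]] by simp
  have real_part: "S \<inter> \<real> = complex_of_real ` X" if "\<And>c. complex_of_real c \<in> S \<longleftrightarrow> c \<in> X" for S X
    using that by (auto simp: Reals_def)
  show ?thesis
  proof (intro bexI[OF _ c_minus(1)] bexI[OF _ c_plus(1)] conjI)
    show "op_spectrum (A0 g u H) \<inter> \<real> = complex_of_real ` ({c_minus, c_plus} \<union> u ` {0..1})"
      by (rule real_part[OF spectrum])
    show "discrete_spectrum (A0 g u H) \<inter> \<real> = complex_of_real ` {c_minus, c_plus}"
      by (rule real_part[OF discrete])
    show "op_eigenvalue (A0 g u H) (complex_of_real c_minus)"
      "op_eigenvalue (A0 g u H) (complex_of_real c_plus)"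
      using eigenvalue c_minus(1) c_plus(1) by auto
    show "{c \<in> J_minus \<union> J_plus. op_eigenvalue (A0 g u H) (complex_of_real c)} = {c_minus, c_plus}"
      using eigenvalue c_minus(1) c_plus(1) by auto
  qed
qed

end
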